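(* Let $m>1$ and $p$ be positive integers, and let $x$ satisfy $0<|x|\le (m-1)^{m-1}/m^m$. Then \[ \sum_{n=1}^\infty\binom{mn}{n}\frac{(-x)^n}{n^{p+1}}=-\sum_{k=0}^{p-1}\sum_{\substack{0\le j+l\le k\\ j,l\ge0}}(-1)^{l+k}\frac{(j+1)m^{j+1}}{(p-1-k)!\,(k-j-l)!}\log^{p-1-k}(|x|)\log^{k-j-l}\big(|1-G_m(-x)|\big) \] \[ \times\Big\{\mathrm{Li}_{l+2,\{1\}_j}\big(1-G_m(-x)\big)+m\,\mathrm{Li}_{l+1,\{1\}_{j+1}}\big(1-G_m(-x)\big)\Big\}. \]
   Context: $G_m(x):=\sum_{n=0}^\infty\frac{1}{(m-1)n+1}\binom{mn}{n}x^n$ for $|x|\le (m-1)^{m-1}/m^m$ (generating function of the Fuss–Catalan numbers); it satisfies $G_m(x)=1+xG_m(x)^m$, $G_m(0)=1$, and takes values in $(1/2,2]$ on this interval. For positive integers $k_1,\dots,k_r$, the single-variable multiple polylogarithm is $\mathrm{Li}_{k_1,\dots,k_r}(y):=\sum_{n_1>n_2>\cdots>n_r>0}\frac{y^{n_1}}{n_1^{k_1}\cdots n_r^{k_r}}$, and $\{1\}_r$ denotes $1$ repeated $r$ times. Convention: $\log^0(\cdot)=1$. *)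

theory Defs
  imports "HOL-Analysis.Analysis"
begin

text \<open>
  Meaningful for \<open>m > 1\<close> and \<open>\<bar>x\<bar> \<le> (m - 1) ^ (m - 1) / m ^ m\<close>, where the series converges.
\<close>

definition fuss_catalan_gf :: "nat \<Rightarrow> real \<Rightarrow> real" where
  "fuss_catalan_gf m x = (\<Sum>n. real (m * n choose n) / real ((m - 1) * n + 1) * x ^ n)"

text \<open>
  The sum of \<open>1 / (n\<^sub>1 ^ k\<^sub>1 * \<dots> * n\<^sub>r ^ k\<^sub>r)\<close> over all \<open>N > n\<^sub>1 > \<dots> > n\<^sub>r > 0\<close>,
  for \<open>ks = [k\<^sub>1, \<dots>, k\<^sub>r]\<close>.
\<close>

primrec mult_harm_sum :: "nat list \<Rightarrow> nat \<Rightarrow> real" where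
  "mult_harm_sum [] N = 1"
| "mult_harm_sum (k # ks) N = (\<Sum>n\<in>{0<..<N}. mult_harm_sum ks n / real n ^ k)"

text \<open>
  The single-variable multiple polylogarithm. The defining series is summed over the outermost
  (largest) index \<open>n\<^sub>1 = Suc n\<close>, the inner sums being finite; this also covers the conditionally
  convergent boundary value at \<open>y = -1\<close> when \<open>k\<^sub>1 = 1\<close>. The empty index list does not occur in
  the intended use; there the value is the usual convention 1.
\<close>

primrec mult_polylog :: "nat list \<Rightarrow> real \<Rightarrow> real" where
  "mult_polylog [] y = 1"
| "mult_polylog (k # ks) y =
     (\<Sum>n. y ^ Suc n / real (Suc n) ^ k * mult_harm_sum ks (Suc n))"

end

theory Submission
  imports Defs
begin

text \<open>
  Put \<open>z = - x\<close>, \<open>G = G\<^sub>m\<close> and \<open>y = 1 - G(z)\<close>. Let \<open>B = X (1 + X)\<^bsup>-m\<^esup>\<close>. The coefficients of the compositions of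
  \<open>\<Sum>n. (mn choose n) X\<^sup>n / ((m - 1) n + 1)\<close> and \<open>\<Sum>n>0. (mn choose n) X\<^sup>n / n\<close> with \<open>B\<close> are
  \<open>N\<close>-th finite differences of polynomials of degree less than \<open>N\<close> (for \<open>N > 1\<close> in the first case, and with the
  term \<open>n = 0\<close> left out in the second), so these compositions are \<open>1 + X\<close> and
  \<open>m log (1 + X)\<close>. Inverting \<open>B\<close> gives \<open>G(z) = 1 + z G(z)\<^sup>m\<close> and \<open>\<Sum>n>0. (mn choose n) z\<^sup>n / n = m ln G(z)\<close>.

  Hence \<open>ln \<bar>z\<bar> = ln \<bar>y\<bar> - m ln (1 - y)\<close>. Expanding a power of \<open>ln \<bar>z\<bar>\<close> by the binomial theorem shows that the
  inner sum of the formula, as a function \<open>S\<^sub>k\<close> of \<open>z\<close>, has derivative \<open>- m ln G(z) (ln \<bar>z\<bar>)\<^sup>k / (k! z)\<close>. So both sides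
  satisfy the same recursion \<open>z F\<^sub>p' = F\<^sub>p\<^sub>-\<^sub>1\<close> inside the interval. As both are continuous up to the
  boundary and vanish at \<open>0\<close>, they agree.
\<close>

section \<open>Formal identities for the Fuss--Catalan series\<close>

text \<open>Induction on \<open>N\<close>. Split \<open>q\<close> into its constant term and X times
  \<open>r\<close>. The constant contributes an alternating sum over a full row of binomial
  coefficients, which is 0. The absorption rule n (N+1 choose n) = (N+1) (N choose n-1) turns the
  rest into the same kind of sum for \<open>r\<close> shifted by 1, whose degree is smaller.\<close>

lemma sum_alternating_binomial_poly:
  fixes q :: "'a :: idom poly"
  assumes "degree q < N"
  shows "(\<Sum>n\<le>N. (- 1) ^ n * of_nat (N choose n) * poly q (of_nat n)) = 0"
  using assms
proof (induction N arbitrary: q)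
  case (Suc N)
  obtain c r where q: "q = pCons c r"
    by (cases q)
  define s where "s = r \<circ>\<^sub>p [:1, 1:]"
  have s: "(\<Sum>n\<le>N. (- 1) ^ n * of_nat (N choose n) * poly s (of_nat n)) = 0"
  proof (cases "r = 0")
    case False
    then have "degree s < N"
      using Suc.prems by (simp add: q s_def degree_pcompose)
    then show ?thesis
      by (rule Suc.IH)
  qed (simp add: s_def)
  have "(\<Sum>n\<le>Suc N. (- 1) ^ n * of_nat (Suc N choose n) * poly q (of_nat n))
      = c * (\<Sum>n\<le>Suc N. (- 1) ^ n * of_nat (Suc N choose n))
        + (\<Sum>n\<le>Suc N. (- 1) ^ n * of_nat (Suc N choose n) * (of_nat n * poly r (of_nat n)))"
    by (simp add: q sum_distrib_left algebra_simps sum.distrib del: sum.atMost_Suc binomial_Suc_Suc)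
  also have "(\<Sum>n\<le>Suc N. (- 1) ^ n * of_nat (Suc N choose n)) = (0 :: 'a)"
    by (rule choose_alternating_sum) simp
  also have "(\<Sum>n\<le>Suc N. (- 1) ^ n * of_nat (Suc N choose n) * (of_nat n * poly r (of_nat n)))
      = (\<Sum>n\<le>N. (- 1) ^ Suc n * of_nat (Suc n * (Suc N choose Suc n)) * poly r (of_nat (Suc n)))"
    by (subst sum.atMost_Suc_shift) (simp add: algebra_simps del: binomial_Suc_Suc)
  also have "\<dots> = - of_nat (Suc N) * (\<Sum>n\<le>N. (- 1) ^ n * of_nat (N choose n) * poly s (of_nat n))"
    unfolding Suc_times_binomial sum_distrib_left s_def
    by (intro sum.cong refl) (simp add: poly_pcompose algebra_simps)
  finally show ?case
    by (simp add: s del: sum.atMost_Suc)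
qed simp

text \<open>For n > 0 the first binomial is a product of consecutive numbers ending at mn, the
  second one, up to sign, a product of consecutive numbers starting at mn. Glued together at mn they
  form a single Pochhammer symbol of length \<open>N - 1\<close> and one spare factor mn. In this
  form the left side is a sign and \<open>N choose n\<close> times a polynomial in n, ready for the
  vanishing of finite differences.\<close>

lemma binomial_mult_gbinomial_neg:
  fixes m n N :: nat
  assumes "0 < N" "n \<le> N"
  shows "real (m * n choose n) * ((- real (m * n)) gchoose (N - n))
    = (- 1) ^ (N - n) * real (N choose n) * real (m * n) * pochhammer (real m * real n - real n + 1) (N - 1) / fact N"
proof (cases n)
  case 0
  then show ?thesis
    using assms(1) by (cases N) auto
next
  case (Suc k)
  show ?thesis
  proof (cases "m = 0")
    case True
    then show ?thesis using Suc by simp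
  next
    case False
    let ?c = "real m * real n - real n"
    have "real (m * n) gchoose n = pochhammer (?c + 1) n / fact n"
      by (simp add: gbinomial_pochhammer' algebra_simps)
    also have "pochhammer (?c + 1) n = pochhammer (?c + 1) k * (real m * real n)"
      by (simp add: Suc pochhammer_Suc)
    finally have 1: "real (m * n choose n) = pochhammer (?c + 1) k * (real m * real n) / fact n"
      by (simp add: binomial_gbinomial)
    have 2: "(- real (m * n)) gchoose (N - n) = (- 1) ^ (N - n) * pochhammer (real m * real n) (N - n) / fact (N - n)"
      by (simp add: gbinomial_pochhammer)
    have "pochhammer (?c + 1) (N - 1) = pochhammer (?c + 1) k * pochhammer (?c + 1 + real k) (N - 1 - k)"
      using assms Suc by (intro pochhammer_product) auto
    also have "?c + 1 + real k = real m * real n" by (simp add: Suc)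
    also have "N - 1 - k = N - n" by (simp add: Suc)
    finally have 3: "pochhammer (?c + 1) (N - 1) = pochhammer (?c + 1) k * pochhammer (real m * real n) (N - n)" .
    show ?thesis
      unfolding 1 2 3 binomial_fact[OF assms(2), where 'a = real] by simp
  qed
qed

lemma fps_binomial_power: "fps_binomial c ^ n = fps_binomial (of_nat n * c)"
  for c :: "'a :: field_char_0"
  by (induction n) (simp_all add: algebra_simps fps_binomial_add_mult)

definition fc_fps :: "nat \<Rightarrow> real fps" where
  "fc_fps m = Abs_fps (\<lambda>n. real (m * n choose n) / real ((m - 1) * n + 1))"

text \<open>The constant coefficient is \<open>1 / 0 = 0\<close>.\<close>
definition fc_log_fps :: "nat \<Rightarrow> real fps" where
  "fc_log_fps m = Abs_fps (\<lambda>n. real (m * n choose n) / real n)"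

lemma minus_one_power_diff_nat: "n \<le> N \<Longrightarrow> (- 1) ^ (N - n) = (- 1) ^ N * (- 1 :: 'a :: comm_ring_1) ^ n"
  by (auto simp: minus_one_power_iff)

context
  fixes m :: nat
  assumes m: "m > 1"
begin

lemma fuss_catalan_kernel_power_nth:
  "fps_nth ((fps_X * fps_binomial (- real m)) ^ i) n = (if n < i then 0 else (- real (m * i)) gchoose (n - i))"
  by (simp add: power_mult_distrib fps_binomial_power fps_X_power_mult_nth algebra_simps)

lemma compose_kernel_nth:
  "fps_nth (f oo (fps_X * fps_binomial (- real m))) n = (\<Sum>i\<le>n. fps_nth f i * ((- real (m * i)) gchoose (n - i)))"
  by (simp add: fps_compose_nth fuss_catalan_kernel_power_nth atLeast0AtMost)

text \<open>Division by \<open>i\<close> cancels the spare factor, so each summand with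
  \<open>i > 0\<close> is a signed binomial coefficient times a polynomial of degree below
  \<open>N\<close>. Over all \<open>i\<close> such a sum vanishes, but the series has coefficient 0
  at \<open>i = 0\<close>. What remains is minus the missing term, \<open>- fact M\<close>, which
  produces the coefficient of the logarithm.\<close>

lemma fc_log_fps_compose: "fc_log_fps m oo (fps_X * fps_binomial (- real m)) = fps_const (real m) * fps_ln 1"
proof (rule fps_ext)
  fix N
  show "fps_nth (fc_log_fps m oo (fps_X * fps_binomial (- real m))) N = fps_nth (fps_const (real m) * fps_ln 1) N"
  proof (cases N)
    case 0
    then show ?thesis by (simp add: fc_log_fps_def)
  next
    case (Suc M)
    define q where "q = (\<Prod>i<M. [:1 + real i, real m - 1:])"
    have "degree q \<le> (\<Sum>i<M. degree [:1 + real i, real m - 1:])"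
      unfolding q_def by (rule order_trans[OF degree_prod_sum_le]) auto
    also have "\<dots> \<le> (\<Sum>i<M. 1)"
      by (intro sum_mono) auto
    finally have deg: "degree q < N" by (simp add: Suc)
    have poch: "pochhammer (real m * real n - real n + 1) M = poly q (real n)" for n
      unfolding q_def poly_prod pochhammer_prod
      by (simp add: algebra_simps atLeast0LessThan)
    have *: "fps_nth (fc_log_fps m) i * ((- real (m * i)) gchoose (N - i))
        = (- 1) ^ N * real m / fact N * ((- 1) ^ i * of_nat (N choose i) * poly q (of_nat i))"
      if "i \<in> {..N} - {0}" for i
    proof -
      have "fps_nth (fc_log_fps m) i * ((- real (m * i)) gchoose (N - i))
          = real (m * i choose i) * ((- real (m * i)) gchoose (N - i)) / real i"
        by (simp add: fc_log_fps_def)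
      also have "\<dots> = (- 1) ^ N * real m / fact N * ((- 1) ^ i * of_nat (N choose i) * poly q (of_nat i))"
        using that
        by (subst binomial_mult_gbinomial_neg)
          (auto simp: Suc poch minus_one_power_diff_nat simp del: binomial_Suc_Suc power_Suc fact_Suc of_nat_Suc)
      finally show ?thesis .
    qed
    have "fps_nth (fc_log_fps m oo (fps_X * fps_binomial (- real m))) N
        = (\<Sum>i\<in>{..N} - {0}. fps_nth (fc_log_fps m) i * ((- real (m * i)) gchoose (N - i)))"
      unfolding compose_kernel_nth by (subst sum.remove[of _ 0]) (auto simp: fc_log_fps_def)
    also have "\<dots> = (- 1) ^ N * real m / fact N *
        (\<Sum>i\<in>{..N} - {0}. (- 1) ^ i * of_nat (N choose i) * poly q (of_nat i))"
      unfolding sum_distrib_left by (intro sum.cong refl *)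
    also have "(\<Sum>i\<in>{..N} - {0}. (- 1) ^ i * of_nat (N choose i) * poly q (of_nat i))
        = (\<Sum>i\<le>N. (- 1) ^ i * of_nat (N choose i) * poly q (of_nat i)) - poly q 0"
      by (subst (2) sum.remove[of _ 0]) auto
    also have "poly q 0 = fact M"
      using poch[of 0] by (simp add: pochhammer_fact)
    also have "(\<Sum>i\<le>N. (- 1) ^ i * of_nat (N choose i) * poly q (of_nat i)) = 0"
      by (rule sum_alternating_binomial_poly[OF deg])
    finally show ?thesis
      by (simp add: Suc fps_ln_nth del: of_nat_Suc)
  qed
qed

lemma fc_fps_compose: "fc_fps m oo (fps_X * fps_binomial (- real m)) = 1 + fps_X"
proof (rule fps_ext)
  fix N
  consider "N = 0" | "N = 1" | M where "N = Suc (Suc M)"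
    by (metis One_nat_def not0_implies_Suc)
  then show "fps_nth (fc_fps m oo (fps_X * fps_binomial (- real m))) N = fps_nth (1 + fps_X) N"
  proof cases
    case 1
    then show ?thesis by (simp add: fc_fps_def)
  next
    case 2
    then show ?thesis
      using m unfolding compose_kernel_nth by (simp add: fc_fps_def)
  next
    case (3 M)
    \<comment> \<open>The denominator \<open>(m - 1) * n + 1\<close> is the first factor of the
      Pochhammer symbol and cancels. The factor \<open>m * n\<close> and \<open>M\<close> linear
      factors are left, so the degree is at most \<open>M + 1 < N\<close>. For \<open>N < 2\<close>
      the symbol is empty and nothing can cancel, hence the separate cases.\<close>
    define q where "q = [:0, real m:] * (\<Prod>i<M. [:2 + real i, real m - 1:])"
    have "degree q \<le> 1 + (\<Sum>i<M. degree [:2 + real i, real m - 1:])"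
      unfolding q_def using m
      by (intro order_trans[OF degree_mult_le] add_mono order_trans[OF degree_prod_sum_le]) auto
    also have "(\<Sum>i<M. degree [:2 + real i, real m - 1:]) \<le> (\<Sum>i<M. 1)"
      by (intro sum_mono) auto
    finally have deg: "degree q < N" by (simp add: 3)
    have poch: "real (m * n) * pochhammer (real m * real n - real n + 1) (Suc M) / real ((m - 1) * n + 1) = poly q (real n)" for n
    proof -
      have 1: "real ((m - 1) * n + 1) = real m * real n - real n + 1"
        using m by (simp add: of_nat_diff algebra_simps)
      have 2: "real m * real n - real n + 1 \<noteq> 0"
        unfolding 1[symmetric] by linarith
      have 3: "pochhammer (real m * real n - real n + 1 + 1) M = poly (\<Prod>i<M. [:2 + real i, real m - 1:]) (real n)"
        by (simp add: pochhammer_prod poly_prod atLeast0LessThan algebra_simps)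
      show ?thesis
        unfolding q_def poly_mult pochhammer_rec 1 3 using 2 by simp
    qed
    have *: "fps_nth (fc_fps m) i * ((- real (m * i)) gchoose (N - i))
        = (- 1) ^ N / fact N * ((- 1) ^ i * of_nat (N choose i) * poly q (of_nat i))"
      if "i \<in> {..N}" for i
    proof -
      have "fps_nth (fc_fps m) i * ((- real (m * i)) gchoose (N - i))
          = real (m * i choose i) * ((- real (m * i)) gchoose (N - i)) / real ((m - 1) * i + 1)"
        by (simp add: fc_fps_def)
      also have "\<dots> = (- 1) ^ N / fact N * ((- 1) ^ i * of_nat (N choose i) *
          (real (m * i) * pochhammer (real m * real i - real i + 1) (Suc M) / real ((m - 1) * i + 1)))"
        using that
        by (subst binomial_mult_gbinomial_neg)
          (auto simp: 3 minus_one_power_diff_nat simp del: binomial_Suc_Suc power_Suc fact_Suc of_nat_Suc)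
      finally show ?thesis unfolding poch .
    qed
    have "fps_nth (fc_fps m oo (fps_X * fps_binomial (- real m))) N
       = (- 1) ^ N / fact N * (\<Sum>i\<le>N. (- 1) ^ i * of_nat (N choose i) * poly q (of_nat i))"
      unfolding compose_kernel_nth sum_distrib_left by (intro sum.cong refl *)
    also have "\<dots> = 0"
      by (simp only: sum_alternating_binomial_poly[OF deg])
    finally show ?thesis
      by (simp add: 3)
  qed
qed

text \<open>Composition with the compositional inverse \<open>C\<close> of \<open>B\<close> turns
  the two preceding identities into \<open>fc_fps m = 1 + C\<close> and
  \<open>fc_log_fps m = m ln (1 + C)\<close>. The first claim is then B(C) = X cleared of
  denominators. The second is the differentiated logarithm, also without division, so that
  evaluating it needs only products of series.\<close>

lemma fc_fps_eqs:
  shows fc_fps_eq: "fc_fps m = 1 + fps_X * fc_fps m ^ m"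
    and fc_log_fps_deriv: "fps_deriv (fc_log_fps m) * fc_fps m = fps_const (real m) * fps_deriv (fc_fps m)"
proof -
  define B where "B = fps_X * fps_binomial (- real m)"
  define C where "C = fps_inv B"
  have B0: "fps_nth B 0 = 0" and B1: "fps_nth B 1 \<noteq> 0"
    by (simp_all add: B_def)
  have C0: "fps_nth C 0 = 0"
    by (simp add: C_def fps_inv_def)
  have BC: "B oo C = fps_X"
    unfolding C_def by (rule fps_inv_right[OF B0 B1])
  have cancel: "(f oo B) oo C = f" for f
    using fps_compose_assoc[OF C0 B0, of f] by (simp add: BC)
  have A: "fc_fps m = 1 + C"
    using cancel[of "fc_fps m"] C0
    by (simp add: B_def fc_fps_compose fps_compose_add_distrib)
  have "B * (1 + fps_X) ^ m = fps_X * (fps_binomial (- real m) * fps_binomial (real m))"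
    by (simp add: B_def fps_binomial_of_nat mult.assoc)
  also have "\<dots> = fps_X"
    by (subst fps_binomial_add_mult[symmetric]) simp
  finally have "(B * (1 + fps_X) ^ m) oo C = fps_X oo C" by simp
  then have "fps_X * (1 + C) ^ m = C"
    using C0
    by (simp add: fps_compose_mult_distrib fps_compose_power[symmetric] fps_compose_add_distrib BC)
  then show "fc_fps m = 1 + fps_X * fc_fps m ^ m"
    by (simp add: A)
  have D: "fc_log_fps m = fps_const (real m) * (fps_ln 1 oo C)"
    using cancel[of "fc_log_fps m"] C0 by (simp add: B_def fc_log_fps_compose fps_compose_mult_distrib)
  have "fps_deriv (fc_log_fps m) = fps_const (real m) * ((inverse (1 + fps_X) oo C) * fps_deriv C)"
    using C0 by (simp add: D fps_compose_deriv fps_ln_deriv)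
  moreover have "(inverse (1 + fps_X) oo C) * (1 + C) = 1"
  proof -
    have "(inverse (1 + fps_X) oo C) * (1 + C) = (inverse (1 + fps_X) * (1 + fps_X)) oo C"
      using C0 by (simp add: fps_compose_mult_distrib fps_compose_add_distrib)
    also have "inverse (1 + fps_X) * (1 + fps_X) = (1 :: real fps)"
      by (rule inverse_mult_eq_1) simp
    finally show ?thesis by simp
  qed
  ultimately show "fps_deriv (fc_log_fps m) * fc_fps m = fps_const (real m) * fps_deriv (fc_fps m)"
    by (simp add: A mult.assoc mult.left_commute)
qed

end

section \<open>Single-variable multiple polylogarithms\<close>

lemma continuous_on_powser_abs:
  fixes b :: "nat \<Rightarrow> real"
  assumes "summable (\<lambda>n. \<bar>b n\<bar> * r ^ n)"
  shows "continuous_on {- r..r} (\<lambda>u. \<Sum>n. b n * u ^ n)"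
proof (rule uniform_limit_theorem)
  show "uniform_limit {- r..r} (\<lambda>N u. \<Sum>n<N. b n * u ^ n) (\<lambda>u. \<Sum>n. b n * u ^ n) sequentially"
    by (rule Weierstrass_m_test[OF _ assms])
      (auto simp: abs_mult power_abs intro!: mult_left_mono power_mono)
qed (auto intro!: always_eventually continuous_intros)

text \<open>Summation by parts: \<open>(1 - u) * (\<Sum>n. a n * u ^ n)\<close> has coefficients \<open>a (Suc n) - a n\<close>, so it converges
  absolutely even at \<open>u = - 1\<close>, where the multiple polylogarithms with leading index \<open>1\<close> converge only
  conditionally.\<close>
lemma powser_bounded_variation:
  fixes a :: "nat \<Rightarrow> real"
  assumes lim: "a \<longlonglongrightarrow> 0" and bv: "summable (\<lambda>n. \<bar>a (Suc n) - a n\<bar>)"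
  shows summable_powser_bounded_variation: "u \<in> {- 1..<1} \<Longrightarrow> summable (\<lambda>n. a n * u ^ n)"
    and continuous_on_powser_bounded_variation: "continuous_on {- 1..<1} (\<lambda>u. \<Sum>n. a n * u ^ n)"
proof -
  define b where "b = (\<lambda>n. a (Suc n) - a n)"
  define B where "B = (\<lambda>u. \<Sum>n. b n * u ^ n)"
  have sums: "(\<lambda>n. a n * u ^ n) sums ((a 0 + u * B u) / (1 - u))" if u: "u \<in> {- 1..<1}" for u
  proof -
    have "summable (\<lambda>n. b n * u ^ n)"
      using u bv
      by (intro summable_comparison_test'[OF bv, of 0])
        (auto simp: b_def abs_mult power_abs intro!: mult_left_le power_le_one)
    then have B: "(\<lambda>N. \<Sum>n<N. b n * u ^ n) \<longlonglongrightarrow> B u"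
      unfolding B_def by (intro summable_LIMSEQ)
    have "(\<lambda>N. a N * u ^ N) \<longlonglongrightarrow> 0"
    proof (rule tendsto_rabs_zero_cancel, rule tendsto_sandwich[OF _ _ tendsto_const])
      show "eventually (\<lambda>N. \<bar>a N * u ^ N\<bar> \<le> \<bar>a N\<bar>) sequentially"
        using u by (intro always_eventually allI) (auto simp: abs_mult power_abs intro!: mult_left_le power_le_one)
      show "(\<lambda>N. \<bar>a N\<bar>) \<longlonglongrightarrow> 0"
        using lim by (rule tendsto_rabs_zero)
    qed auto
    then have "(\<lambda>N. (a 0 + u * (\<Sum>n<N. b n * u ^ n) - a N * u ^ N) / (1 - u)) \<longlonglongrightarrow> (a 0 + u * B u - 0) / (1 - u)"
      using u by (intro tendsto_intros B) auto
    moreover have "(a 0 + u * (\<Sum>n<N. b n * u ^ n) - a N * u ^ N) / (1 - u) = (\<Sum>n<N. a n * u ^ n)" for N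
    proof -
      have "(1 - u) * (\<Sum>n<N. a n * u ^ n) = a 0 + u * (\<Sum>n<N. b n * u ^ n) - a N * u ^ N"
      proof (induction N)
        case (Suc N)
        have "(1 - u) * (\<Sum>n<Suc N. a n * u ^ n) = (1 - u) * (\<Sum>n<N. a n * u ^ n) + (1 - u) * (a N * u ^ N)"
          by (simp add: algebra_simps)
        also have "\<dots> = a 0 + u * (\<Sum>n<Suc N. b n * u ^ n) - a (Suc N) * u ^ Suc N"
          unfolding Suc.IH by (simp add: algebra_simps) (simp add: b_def algebra_simps)
        finally show ?case .
      qed simp
      then show ?thesis
        using u by (simp add: field_simps)
    qed
    ultimately show ?thesis
      by (simp add: sums_def)
  qed
  show "u \<in> {- 1..<1} \<Longrightarrow> summable (\<lambda>n. a n * u ^ n)"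
    using sums by (rule sums_summable)
  have "continuous_on {- 1..1} B"
    unfolding B_def using continuous_on_powser_abs[of b 1] bv by (simp add: b_def)
  then have "continuous_on {- 1..<1} B"
    by (rule continuous_on_subset) auto
  then have "continuous_on {- 1..<1} (\<lambda>u. (a 0 + u * B u) / (1 - u))"
    by (intro continuous_intros) auto
  then show "continuous_on {- 1..<1} (\<lambda>u. \<Sum>n. a n * u ^ n)"
    by (rule continuous_on_eq) (use sums in \<open>simp add: sums_iff\<close>)
qed

section \<open>Growth and variation of multiple harmonic sums\<close>

lemma mult_harm_sum_nonneg: "mult_harm_sum ks n \<ge> 0"
  by (induction ks arbitrary: n) (auto intro!: sum_nonneg)

lemma mult_harm_sum_Suc:
  assumes "n > 0"
  shows "mult_harm_sum (k # ks) (Suc n) = mult_harm_sum (k # ks) n + mult_harm_sum ks n / real n ^ k"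
proof -
  have "{0<..<Suc n} = insert n {0<..<n}" using assms by auto
  then show ?thesis by simp
qed

lemma mult_harm_sum_Cons_0 [simp]: "mult_harm_sum (k # ks) 0 = 0"
  by simp

lemma mult_harm_sum_Cons_1 [simp]: "mult_harm_sum (k # ks) (Suc 0) = 0"
proof -
  have "{0<..<Suc 0} = {}" by auto
  then show ?thesis by simp
qed

lemma mult_polylog_Cons_0 [simp]: "mult_polylog (k # ks) 0 = 0"
  by simp

declare mult_harm_sum.simps(2) [simp del] mult_polylog.simps(2) [simp del]

text \<open>The true growth is at most a power of the logarithm; a square root is easier to carry
  through the recursion and still leaves summable differences. Each nesting level sums terms of size
  at most a constant times 1 / sqrt n, and these telescope against 3 (sqrt (n+1) - sqrt n), which
  gives one factor 3 per level.\<close>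

lemma mult_harm_sum_le_sqrt:
  assumes "0 \<notin> set ks" "n > 0"
  shows "mult_harm_sum ks n \<le> 3 ^ length ks * sqrt (real n)"
  using assms
proof (induction ks arbitrary: n)
  case (Cons k ks)
  from Cons.prems(2) show ?case
  proof (induction n rule: nat_induct_non_zero)
    case (Suc n)
    have 1: "mult_harm_sum ks n / real n ^ k \<le> 3 ^ length ks * sqrt (real n) / real n"
    proof (rule frac_le)
      show "mult_harm_sum ks n \<le> 3 ^ length ks * sqrt (real n)"
        using Cons Suc by auto
      have "real n ^ 1 \<le> real n ^ k"
        using Cons.prems(1) Suc by (intro power_increasing) auto
      then show "real n \<le> real n ^ k" by simp
    qed (use Suc in auto)
    have 2: "sqrt (real n) / real n \<le> 3 * (sqrt (real (Suc n)) - sqrt (real n))"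
    proof -
      \<comment> \<open>The constant 3 comes from \<open>t <= 2 * s\<close>: then
        \<open>t + s <= 3 * s\<close>, while \<open>t - s = 1 / (t + s)\<close>.\<close>
      define s t where "s = sqrt (real n)" and "t = sqrt (real (Suc n))"
      have s: "s > 0" "t > 0" "t \<le> 2 * s"
        using Suc.hyps unfolding s_def t_def
        by (auto intro!: real_le_lsqrt simp: power_mult_distrib)
      have "s\<^sup>2 = real n" "t\<^sup>2 = real n + 1"
        by (simp_all add: s_def t_def)
      then have "(t - s) * (t + s) = 1"
        by (simp add: algebra_simps power2_eq_square)
      then have "t - s = 1 / (t + s)"
        using s by (simp add: field_simps)
      moreover have "s / real n = 1 / s"
        unfolding \<open>s\<^sup>2 = real n\<close>[symmetric] using s by (simp add: power2_eq_square)
      moreover have "1 / s \<le> 3 * (1 / (t + s))"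
        using s by (simp add: field_simps)
      ultimately show ?thesis
        unfolding s_def t_def by simp
    qed
    have "mult_harm_sum (k # ks) (Suc n) \<le> 3 ^ Suc (length ks) * sqrt (real n) + 3 ^ length ks * (sqrt (real n) / real n)"
      using Suc.IH 1 unfolding mult_harm_sum_Suc[OF Suc.hyps] by simp
    also have "\<dots> \<le> 3 ^ Suc (length ks) * sqrt (real n) + 3 ^ length ks * (3 * (sqrt (real (Suc n)) - sqrt (real n)))"
      by (intro add_mono mult_left_mono 2) auto
    finally show ?case
      by (simp add: algebra_simps)
  qed simp
qed simp

lemma mult_harm_sum_Suc_diff:
  assumes "0 \<notin> set ks" "n > 0"
  shows "mult_harm_sum ks n \<le> mult_harm_sum ks (Suc n)"
    and "mult_harm_sum ks (Suc n) - mult_harm_sum ks n \<le> 3 ^ length ks * sqrt (real n) / real n"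
proof -
  show "mult_harm_sum ks n \<le> mult_harm_sum ks (Suc n)"
    by (cases ks) (auto simp: mult_harm_sum_Suc[OF assms(2)] mult_harm_sum_nonneg)
  show "mult_harm_sum ks (Suc n) - mult_harm_sum ks n \<le> 3 ^ length ks * sqrt (real n) / real n"
  proof (cases ks)
    case (Cons k ks')
    have "mult_harm_sum ks' n / real n ^ k \<le> 3 ^ length ks * sqrt (real n) / real n"
    proof (rule frac_le)
      have "mult_harm_sum ks' n \<le> 3 ^ length ks' * sqrt (real n)"
        using assms Cons by (intro mult_harm_sum_le_sqrt) auto
      also have "\<dots> \<le> 3 ^ length ks * sqrt (real n)"
        by (intro mult_right_mono power_increasing) (auto simp: Cons)
      finally show "mult_harm_sum ks' n \<le> 3 ^ length ks * sqrt (real n)" .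
      have "real n ^ 1 \<le> real n ^ k"
        using assms Cons by (intro power_increasing) auto
      then show "real n \<le> real n ^ k" by simp
    qed (use assms in auto)
    then show ?thesis
      unfolding Cons mult_harm_sum_Suc[OF assms(2)] by simp
  qed simp
qed

text \<open>Bernoulli's inequality for the power \<open>r ^ k\<close> with r = n / (n+1), which is
  close to 1.\<close>

lemma inverse_power_diff_le:
  assumes "n > 0" "k > 0"
  shows "1 / real n ^ k - 1 / real (Suc n) ^ k \<le> real k / (real n)\<^sup>2"
proof -
  define r where "r = real n / real (Suc n)"
  have r: "r - 1 = - (1 / real (Suc n))"
    by (simp add: r_def field_simps)
  have "1 + real k * (r - 1) \<le> r ^ k"
    using Bernoulli_inequality[of "r - 1" k] by (simp add: r_def)
  then have *: "1 - r ^ k \<le> real k / real (Suc n)"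
    unfolding r by simp
  have "1 / real n ^ k - 1 / real (Suc n) ^ k = 1 / real n ^ k * (1 - r ^ k)"
    using assms by (simp add: r_def power_divide divide_simps)
  also have "\<dots> \<le> 1 / real n * (real k / real (Suc n))"
  proof (rule mult_mono)
    have "real n ^ 1 \<le> real n ^ k"
      using assms by (intro power_increasing) auto
    then show "1 / real n ^ k \<le> 1 / real n"
      using assms by (intro divide_left_mono) auto
    show "0 \<le> 1 - r ^ k"
      by (simp add: power_le_one r_def)
  qed (use * in auto)
  also have "\<dots> \<le> real k / (real n)\<^sup>2"
    using assms by (auto simp: power2_eq_square intro!: divide_left_mono)
  finally show ?thesis .
qed

text \<open>One step of the coefficient sequence is \<open>A - B\<close>: \<open>A\<close> comes
  from the growth of the harmonic sum, \<open>B\<close> from the decay of 1 / n^k. Both are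
  nonnegative and at most a constant times sqrt n / n^2 = n powr (-3/2), which is summable.\<close>

lemma polylog_coeff_bounded_variation:
  assumes "0 \<notin> set ks" "k > 0"
  shows "(\<lambda>n. mult_harm_sum ks (Suc n) / real (Suc n) ^ k) \<longlonglongrightarrow> 0"
    and "summable (\<lambda>n. \<bar>mult_harm_sum ks (Suc (Suc n)) / real (Suc (Suc n)) ^ k
            - mult_harm_sum ks (Suc n) / real (Suc n) ^ k\<bar>)"
proof -
  let ?h = "mult_harm_sum ks"
  define C :: real where "C = 3 ^ length ks"
  have C: "C \<ge> 0" by (simp add: C_def)
  have h: "?h n \<le> C * sqrt (real n)" if "n > 0" for n
    using mult_harm_sum_le_sqrt[OF assms(1) that] by (simp add: C_def)
  have pow: "real n \<le> real n ^ k" if "n > 0" for n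
    using power_increasing[of 1 k "real n"] assms that by simp
  have sqrt_div: "sqrt (real n) / real n = real n powr (- 1 / 2)"
    "sqrt (real n) / (real n)\<^sup>2 = real n powr (- 3 / 2)" if "n > 0" for n
  proof -
    have "sqrt (real n) / real n = real n powr (1 / 2) / real n powr 1"
      using that by (simp add: powr_half_sqrt)
    then show "sqrt (real n) / real n = real n powr (- 1 / 2)"
      by (simp only: powr_diff[symmetric]) simp
    have "sqrt (real n) / (real n)\<^sup>2 = real n powr (1 / 2) / real n powr 2"
      using that by (simp add: powr_half_sqrt)
    then show "sqrt (real n) / (real n)\<^sup>2 = real n powr (- 3 / 2)"
      by (simp only: powr_diff[symmetric]) simp
  qed
  show "(\<lambda>n. ?h (Suc n) / real (Suc n) ^ k) \<longlonglongrightarrow> 0"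
  proof (rule tendsto_sandwich[OF _ _ tendsto_const])
    have "(\<lambda>n. C * real n powr (- 1 / 2)) \<longlonglongrightarrow> C * 0"
      by (intro tendsto_intros tendsto_neg_powr filterlim_real_sequentially) auto
    then show "(\<lambda>n. C * real (Suc n) powr (- 1 / 2)) \<longlonglongrightarrow> 0"
      by (subst filterlim_sequentially_Suc) simp
    have "?h (Suc n) / real (Suc n) ^ k \<le> C * sqrt (real (Suc n)) / real (Suc n)" for n
      using C by (intro frac_le h pow) auto
    then show "eventually (\<lambda>n. ?h (Suc n) / real (Suc n) ^ k \<le> C * real (Suc n) powr (- 1 / 2)) sequentially"
      by (intro always_eventually allI) (metis sqrt_div(1) times_divide_eq_right zero_less_Suc)
  qed (auto intro!: always_eventually divide_nonneg_pos mult_harm_sum_nonneg)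
  show "summable (\<lambda>n. \<bar>?h (Suc (Suc n)) / real (Suc (Suc n)) ^ k - ?h (Suc n) / real (Suc n) ^ k\<bar>)"
  proof (rule summable_comparison_test')
    have "summable (\<lambda>n. C * (1 + real k) * real n powr (- 3 / 2))"
      by (intro summable_mult) (simp add: summable_real_powr_iff)
    then show "summable (\<lambda>n. C * (1 + real k) * real (Suc n) powr (- 3 / 2))"
      by (subst summable_Suc_iff)
    fix i :: nat assume "i \<ge> 0"
    define n where "n = Suc i"
    have n: "n > 0" by (simp add: n_def)
    define A where "A = (?h (Suc n) - ?h n) / real (Suc n) ^ k"
    define B where "B = ?h n * (1 / real n ^ k - 1 / real (Suc n) ^ k)"
    have "?h (Suc n) / real (Suc n) ^ k - ?h n / real n ^ k = A - B"
      by (simp add: A_def B_def algebra_simps diff_divide_distrib)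
    then have "\<bar>?h (Suc n) / real (Suc n) ^ k - ?h n / real n ^ k\<bar> \<le> \<bar>A\<bar> + \<bar>B\<bar>"
      by linarith
    also have "\<bar>A\<bar> = A"
      using mult_harm_sum_Suc_diff(1)[OF assms(1) n] by (simp add: A_def)
    also have "A \<le> (C * sqrt (real n) / real n) / real n"
      unfolding A_def
    proof (rule frac_le)
      show "?h (Suc n) - ?h n \<le> C * sqrt (real n) / real n"
        using mult_harm_sum_Suc_diff(2)[OF assms(1) n] by (simp add: C_def)
      show "real n \<le> real (Suc n) ^ k"
        using pow[of "Suc n"] by simp
    qed (use n C in auto)
    also have "\<dots> = C * (sqrt (real n) / (real n)\<^sup>2)"
      by (simp add: power2_eq_square)
    also have "\<bar>B\<bar> = B"
    proof -
      have "1 / real (Suc n) ^ k \<le> 1 / real n ^ k"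
        using n by (intro divide_left_mono power_mono) auto
      then show ?thesis by (simp add: B_def mult_harm_sum_nonneg)
    qed
    also have "B \<le> (C * sqrt (real n)) * (real k / (real n)\<^sup>2)"
      unfolding B_def
    proof (rule mult_mono)
      show "0 \<le> 1 / real n ^ k - 1 / real (Suc n) ^ k"
        using n by (auto intro!: divide_left_mono power_mono)
      show "1 / real n ^ k - 1 / real (Suc n) ^ k \<le> real k / (real n)\<^sup>2"
        using n assms by (intro inverse_power_diff_le)
    qed (use n C h[OF n] in auto)
    also have "C * (sqrt (real n) / (real n)\<^sup>2) + (C * sqrt (real n)) * (real k / (real n)\<^sup>2)
        = C * (1 + real k) * (sqrt (real n) / (real n)\<^sup>2)"
      by (simp add: algebra_simps add_divide_distrib)
    also have "\<dots> = C * (1 + real k) * real n powr (- 3 / 2)"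
      by (simp only: sqrt_div(2)[OF n])
    finally show "norm \<bar>?h (Suc (Suc i)) / real (Suc (Suc i)) ^ k - ?h (Suc i) / real (Suc i) ^ k\<bar>
        \<le> C * (1 + real k) * real (Suc i) powr (- 3 / 2)"
      unfolding n_def by simp
  qed
qed

section \<open>Power series and derivatives of the multiple polylogarithms\<close>

lemma mult_polylog_sums:
  assumes "0 \<notin> set ks" "k > 0" "y \<in> {- 1..<1}"
  shows "(\<lambda>n. mult_harm_sum ks n / real n ^ k * y ^ n) sums mult_polylog (k # ks) y"
proof -
  have "summable (\<lambda>n. y * (mult_harm_sum ks (Suc n) / real (Suc n) ^ k * y ^ n))"
    using assms by (intro summable_mult summable_powser_bounded_variation polylog_coeff_bounded_variation)
  then have "(\<lambda>n. y ^ Suc n / real (Suc n) ^ k * mult_harm_sum ks (Suc n)) sums mult_polylog (k # ks) y"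
    by (simp add: sums_iff mult_ac mult_polylog.simps(2))
  then have "(\<lambda>n. mult_harm_sum ks (Suc n) / real (Suc n) ^ k * y ^ Suc n) sums mult_polylog (k # ks) y"
    by (simp add: mult_ac)
  \<comment> \<open>The shift adds a term at n = 0. It is a division by \<open>0 ^ k\<close>, which
    is 0 because \<open>k > 0\<close>, so its value is 0.\<close>
  from sums_Suc[where f = "\<lambda>n. mult_harm_sum ks n / real n ^ k * y ^ n", OF this] show ?thesis
    using assms by (simp add: zero_power)
qed

text \<open>The quotient by y is again a power series with coefficients of bounded variation, so it
  is continuous at 0 and up to -1. The explicit factor y later absorbs the logarithmic singularities
  at the origin.\<close>

lemma mult_polylog_factor:
  assumes "0 \<notin> set ks" "k > 0"
  obtains H where "continuous_on {- 1..<1} H" "\<And>y. y \<in> {- 1..<1} \<Longrightarrow> mult_polylog (k # ks) y = y * H y"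
proof
  let ?H = "\<lambda>y. \<Sum>n. mult_harm_sum ks (Suc n) / real (Suc n) ^ k * y ^ n"
  show "continuous_on {- 1..<1} ?H"
    using assms by (intro continuous_on_powser_bounded_variation polylog_coeff_bounded_variation)
  show "mult_polylog (k # ks) y = y * ?H y" if "y \<in> {- 1..<1}" for y
  proof -
    have "summable (\<lambda>n. mult_harm_sum ks (Suc n) / real (Suc n) ^ k * y ^ n)"
      using assms that by (intro summable_powser_bounded_variation polylog_coeff_bounded_variation)
    from suminf_mult[OF this, of y] show ?thesis
      by (simp add: mult_ac mult_polylog.simps(2))
  qed
qed

lemma has_real_derivative_mult_polylog_aux:
  assumes "0 \<notin> set ks" "k > 0" "\<bar>y\<bar> < 1"
  shows "(mult_polylog (k # ks) has_real_derivative
      (\<Sum>n. diffs (\<lambda>n. mult_harm_sum ks n / real n ^ k) n * y ^ n)) (at y)"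
    and "summable (\<lambda>n. diffs (\<lambda>n. mult_harm_sum ks n / real n ^ k) n * y ^ n)"
proof -
  let ?a = "\<lambda>n. mult_harm_sum ks n / real n ^ k"
  have sums: "(\<lambda>n. ?a n * z ^ n) sums mult_polylog (k # ks) z" if "norm z < 1" for z
    using that assms by (intro mult_polylog_sums) auto
  have "((\<lambda>z. \<Sum>n. ?a n * z ^ n) has_real_derivative (\<Sum>n. diffs ?a n * y ^ n)) (at y)"
    using assms by (intro termdiffs_strong'[where K = 1] sums_summable[OF sums]) auto
  then show "(mult_polylog (k # ks) has_real_derivative (\<Sum>n. diffs ?a n * y ^ n)) (at y)"
  proof (rule has_field_derivative_transform_within_open[where S = "{- 1<..<1}"])
    show "(\<Sum>n. ?a n * z ^ n) = mult_polylog (k # ks) z" if "z \<in> {- 1<..<1}" for z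
      using that by (intro sums_unique[symmetric] sums) auto
  qed (use assms in auto)
  show "summable (\<lambda>n. diffs ?a n * y ^ n)"
    using assms by (intro termdiff_converges[where K = 1] sums_summable[OF sums]) auto
qed

lemma has_real_derivative_mult_polylog_Suc:
  assumes "0 \<notin> set ks" "k > 0" "\<bar>y\<bar> < 1" "y \<noteq> 0"
  shows "(mult_polylog (Suc k # ks) has_real_derivative mult_polylog (k # ks) y / y) (at y)"
proof -
  let ?a = "\<lambda>n. mult_harm_sum ks n / real n ^ Suc k"
  have "(\<lambda>n. mult_harm_sum ks (Suc n) / real (Suc n) ^ k * y ^ Suc n) sums mult_polylog (k # ks) y"
  proof (subst sums_Suc_iff)
    have "y \<in> {- 1..<1}" using assms by auto
    from mult_polylog_sums[OF assms(1,2) this]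
    show "(\<lambda>n. mult_harm_sum ks n / real n ^ k * y ^ n) sums
        (mult_polylog (k # ks) y + mult_harm_sum ks 0 / real 0 ^ k * y ^ 0)"
      using assms by (simp add: zero_power)
  qed
  then have "(\<lambda>n. mult_harm_sum ks (Suc n) / real (Suc n) ^ k * y ^ Suc n / y) sums (mult_polylog (k # ks) y / y)"
    by (rule sums_divide)
  then have "(\<lambda>n. diffs ?a n * y ^ n) sums (mult_polylog (k # ks) y / y)"
    using assms by (simp add: diffs_def del: of_nat_Suc)
  then show ?thesis
    using has_real_derivative_mult_polylog_aux(1)[OF assms(1) _ assms(3), of "Suc k"] by (simp add: sums_iff)
qed

text \<open>Termwise differentiation cancels the leading 1 / n and leaves the series
  \<open>s\<close> of harmonic sums. Multiplying by 1 - y replaces the coefficients by their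
  increments, which are the coefficients of the polylogarithm with the leading index removed. For an
  empty \<open>ks\<close> it is the geometric series, in agreement with the value 1 of the empty
  polylogarithm.\<close>

lemma has_real_derivative_mult_polylog_1:
  assumes "0 \<notin> set ks" "\<bar>y\<bar> < 1"
  shows "(mult_polylog (1 # ks) has_real_derivative mult_polylog ks y / (1 - y)) (at y)"
proof -
  define s where "s = (\<Sum>n. mult_harm_sum ks (Suc n) * y ^ n)"
  have d: "diffs (\<lambda>n. mult_harm_sum ks n / real n ^ 1) n * y ^ n = mult_harm_sum ks (Suc n) * y ^ n" for n
    by (simp add: diffs_def del: of_nat_Suc)
  have "summable (\<lambda>n. mult_harm_sum ks (Suc n) * y ^ n)"
    using has_real_derivative_mult_polylog_aux(2)[OF assms(1) _ assms(2), of 1] unfolding d by simp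
  then have s: "(\<lambda>n. mult_harm_sum ks (Suc n) * y ^ n) sums s"
    by (simp add: s_def summable_sums)
  have "(1 - y) * s = mult_polylog ks y"
  proof (cases ks)
    case Nil
    have "(\<lambda>n. y ^ n) sums s" using s Nil by simp
    moreover have "(\<lambda>n. y ^ n) sums (1 / (1 - y))"
      using assms by (intro geometric_sums) auto
    ultimately have "s = 1 / (1 - y)" by (rule sums_unique2)
    then show ?thesis using Nil assms by simp
  next
    case (Cons k ks')
    have "(\<lambda>n. mult_harm_sum ks (Suc n) * y ^ Suc n) sums (y * s)"
      using sums_mult[OF s, of y] by (simp add: mult_ac)
    then have "(\<lambda>n. mult_harm_sum ks n * y ^ n) sums (y * s)"
      by (subst (asm) sums_Suc_iff) (simp add: Cons)
    then have "(\<lambda>n. mult_harm_sum ks (Suc n) * y ^ n - mult_harm_sum ks n * y ^ n) sums (s - y * s)"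
      by (rule sums_diff[OF s])
    also have "(\<lambda>n. mult_harm_sum ks (Suc n) * y ^ n - mult_harm_sum ks n * y ^ n)
        = (\<lambda>n. mult_harm_sum ks' n / real n ^ k * y ^ n)"
    proof
      fix n
      show "mult_harm_sum ks (Suc n) * y ^ n - mult_harm_sum ks n * y ^ n = mult_harm_sum ks' n / real n ^ k * y ^ n"
      proof (cases "n = 0")
        case True
        then show ?thesis using assms Cons by (simp add: zero_power)
      next
        case False
        then have "mult_harm_sum ks (Suc n) = mult_harm_sum ks n + mult_harm_sum ks' n / real n ^ k"
          unfolding Cons by (intro mult_harm_sum_Suc) simp
        then show ?thesis by (simp add: distrib_right)
      qed
    qed
    finally have "(\<lambda>n. mult_harm_sum ks' n / real n ^ k * y ^ n) sums (s - y * s)" .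
    moreover have "(\<lambda>n. mult_harm_sum ks' n / real n ^ k * y ^ n) sums mult_polylog ks y"
      unfolding Cons using assms Cons by (intro mult_polylog_sums) auto
    ultimately have "s - y * s = mult_polylog ks y" by (rule sums_unique2)
    then show ?thesis by (simp add: algebra_simps)
  qed
  then have "s = mult_polylog ks y / (1 - y)"
    using assms by (simp add: field_simps)
  then show ?thesis
    using has_real_derivative_mult_polylog_aux(1)[OF assms(1) _ assms(2), of 1] unfolding d s_def by simp
qed

text \<open>Induction on \<open>j\<close>: by the derivative rule for a leading index 1, both sides
  have the same derivative, and for positive \<open>j\<close> both vanish at 0.\<close>

lemma mult_polylog_ones:
  assumes "\<bar>y\<bar> < 1"
  shows "mult_polylog (replicate j 1) y = (- ln (1 - y)) ^ j / fact j"
  using assms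
proof (induction j arbitrary: y)
  case (Suc j)
  let ?f = "\<lambda>y. mult_polylog (1 # replicate j 1) y - (- ln (1 - y)) ^ Suc j / fact (Suc j)"
  have "\<exists>c. \<forall>x\<in>{- 1<..<1}. ?f x = c"
  proof (rule has_field_derivative_zero_constant)
    show "(?f has_real_derivative 0) (at x within {- 1<..<1})" if x: "x \<in> {- 1<..<1}" for x
    proof -
      have 1: "(mult_polylog (1 # replicate j 1) has_real_derivative mult_polylog (replicate j 1) x / (1 - x)) (at x within {- 1<..<1})"
        using x by (intro has_field_derivative_at_within[OF has_real_derivative_mult_polylog_1]) auto
      have 2: "((\<lambda>y. (- ln (1 - y)) ^ Suc j / fact (Suc j)) has_real_derivative
          (- ln (1 - x)) ^ j / fact j / (1 - x)) (at x within {- 1<..<1})"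
      proof -
        have "((\<lambda>y. - ln (1 - y)) has_real_derivative 1 / (1 - x)) (at x within {- 1<..<1})"
          using x by (auto intro!: derivative_eq_intros)
        from DERIV_cdivide[OF DERIV_power_Suc[OF this, of j], of "fact (Suc j)"] show ?thesis
          by (rule DERIV_cong) simp
      qed
      show ?thesis
        using DERIV_diff[OF 1 2] by (rule DERIV_cong) (use Suc.IH[of x] x in auto)
    qed
  qed auto
  then obtain c where c: "\<forall>x\<in>{- 1<..<1}. ?f x = c" ..
  have "?f y = c"
    by (rule bspec[OF c]) (use Suc.prems in auto)
  moreover have "?f 0 = c"
    by (rule bspec[OF c]) auto
  ultimately have "?f y = ?f 0"
    by simp
  then show ?case by simp
qed simp

section \<open>Sums weighted by powers of logarithms\<close>

text \<open>Put s = - ln |t| / 2. Then |sqrt t| = exp (- s), and the claim becomes s^a / exp s -> 0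
  as s tends to infinity. Since \<open>sqrt\<close> is an odd function, the limit covers both signs
  of t.\<close>

lemma ln_abs_power_sqrt_tendsto_0: "((\<lambda>t. ln \<bar>t\<bar> ^ a * sqrt t) \<longlongrightarrow> 0) (at (0 :: real))"
proof (rule tendsto_rabs_zero_cancel)
  have "filterlim abs (at_right (0 :: real)) (at 0)"
    by (auto simp: filterlim_at eventually_at intro!: tendsto_eq_intros exI[of _ 1])
  then have "filterlim (\<lambda>t. ln \<bar>t\<bar>) at_bot (at (0 :: real))"
    by (rule filterlim_compose[OF ln_at_0])
  then have s: "filterlim (\<lambda>t. 1 / 2 * - ln \<bar>t\<bar>) at_top (at (0 :: real))"
    by (intro filterlim_tendsto_pos_mult_at_top[OF tendsto_const]) (simp_all add: filterlim_uminus_at_top)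
  have "((\<lambda>t. \<bar>2 ^ a * ((1 / 2 * - ln \<bar>t\<bar>) ^ a / exp (1 / 2 * - ln \<bar>t\<bar>))\<bar>) \<longlongrightarrow> 0) (at (0 :: real))"
    by (intro tendsto_rabs_zero tendsto_mult_right_zero filterlim_compose[OF tendsto_power_div_exp_0 s])
  then show "((\<lambda>t. \<bar>ln \<bar>t\<bar> ^ a * sqrt t\<bar>) \<longlongrightarrow> 0) (at (0 :: real))"
  proof (rule filterlim_cong[THEN iffD1, rotated -1])
    show "eventually (\<lambda>t :: real. \<bar>2 ^ a * ((1 / 2 * - ln \<bar>t\<bar>) ^ a / exp (1 / 2 * - ln \<bar>t\<bar>))\<bar> = \<bar>ln \<bar>t\<bar> ^ a * sqrt t\<bar>) (at 0)"
    proof (rule eventually_mono[OF eventually_neq_at_within[of 0]])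
      fix t :: real assume t: "t \<noteq> 0"
      have "exp (1 / 2 * - ln \<bar>t\<bar>) = inverse (\<bar>t\<bar> powr (1 / 2))"
        using t by (simp add: powr_def exp_minus)
      also have "\<dots> = inverse \<bar>sqrt t\<bar>"
        by (simp add: powr_half_sqrt real_sqrt_abs2 flip: real_sqrt_abs2)
      finally have e: "exp (1 / 2 * - ln \<bar>t\<bar>) = inverse \<bar>sqrt t\<bar>" .
      have "2 ^ a * (1 / 2 * - ln \<bar>t\<bar>) ^ a = (- ln \<bar>t\<bar>) ^ a"
        by (subst power_mult_distrib[symmetric]) simp
      then have "2 ^ a * ((1 / 2 * - ln \<bar>t\<bar>) ^ a / exp (1 / 2 * - ln \<bar>t\<bar>)) = (- ln \<bar>t\<bar>) ^ a * \<bar>sqrt t\<bar>"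
        unfolding e times_divide_eq_right by (simp only: divide_inverse inverse_inverse_eq)
      then show "\<bar>2 ^ a * ((1 / 2 * - ln \<bar>t\<bar>) ^ a / exp (1 / 2 * - ln \<bar>t\<bar>))\<bar> = \<bar>ln \<bar>t\<bar> ^ a * sqrt t\<bar>"
        by (simp only: abs_mult power_abs abs_minus_cancel abs_idempotent)
    qed
  qed auto
qed

text \<open>At t = 0 the factor \<open>sqrt t\<close> makes the product 0, whatever value
  \<open>ln 0\<close> has, and this agrees with the limit.\<close>

lemma continuous_on_ln_abs_power_sqrt: "continuous_on UNIV (\<lambda>t :: real. ln \<bar>t\<bar> ^ a * sqrt t)"
proof (rule continuous_at_imp_continuous_on, rule ballI)
  fix t :: real
  show "isCont (\<lambda>t. ln \<bar>t\<bar> ^ a * sqrt t) t"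
  proof (cases "t = 0")
    case True
    then show ?thesis
      using ln_abs_power_sqrt_tendsto_0[of a] by (simp add: isCont_def)
  next
    case False
    then show ?thesis by (intro continuous_intros) auto
  qed
qed

lemma has_real_derivative_ln_abs_power:
  fixes t :: real
  assumes "t \<noteq> 0"
  shows "((\<lambda>t. ln \<bar>t\<bar> ^ Suc n / fact (Suc n)) has_real_derivative ln \<bar>t\<bar> ^ n / fact n / t) (at t)"
proof -
  have "((\<lambda>t. ln \<bar>t\<bar>) has_real_derivative 1 / t) (at t)"
  proof (cases "t > 0")
    case True
    then have "(ln has_real_derivative 1 / t) (at t)"
      by (rule DERIV_ln_divide)
    then show ?thesis
      by (rule has_field_derivative_transform_within_open[where S = "{0<..}"]) (use True in auto)
  next
    case False
    then have "t < 0" using assms by simp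
    then have "((\<lambda>t. ln (- t)) has_real_derivative 1 / t) (at t)"
      by (auto intro!: derivative_eq_intros)
    then show ?thesis
      by (rule has_field_derivative_transform_within_open[where S = "{..<0}"]) (use \<open>t < 0\<close> in auto)
  qed
  from DERIV_cdivide[OF DERIV_power_Suc[OF this, of n], of "fact (Suc n)"] show ?thesis
    by (rule DERIV_cong) simp
qed

text \<open>This alternating sum is what repeated integration by parts against powers of the
  logarithm produces. It occurs at two levels of the formula: over l in the variable y = 1 - G(z),
  and over k in the variable z itself.\<close>

definition log_sum :: "(nat \<Rightarrow> real \<Rightarrow> real) \<Rightarrow> nat \<Rightarrow> real \<Rightarrow> real" where
  "log_sum f a t = (\<Sum>l\<le>a. (- 1) ^ l / fact (a - l) * ln \<bar>t\<bar> ^ (a - l) * f l t)"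

lemma log_sum_Suc: "log_sum f (Suc a) t = ln \<bar>t\<bar> ^ Suc a / fact (Suc a) * f 0 t - log_sum (\<lambda>l. f (Suc l)) a t"
  unfolding log_sum_def by (subst sum.atMost_Suc_shift) (simp add: sum_negf)

text \<open>The derivatives telescope. Differentiating the logarithm in front of \<open>f 0\<close>
  gives exactly the derivative of the remaining sum, which starts at \<open>f 1\<close>, and the two
  cancel. Only the term with the derivative of \<open>f 0\<close> survives.\<close>

lemma has_real_derivative_log_sum_chain:
  assumes "t \<noteq> 0" "(f 0 has_real_derivative D) (at t)"
    and "\<And>l. (f (Suc l) has_real_derivative f l t / t) (at t)"
  shows "(log_sum f a has_real_derivative ln \<bar>t\<bar> ^ a / fact a * D) (at t)"
  using assms(2,3)
proof (induction a arbitrary: f D)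
  case 0
  then show ?case by (simp add: log_sum_def)
next
  case (Suc a)
  have 1: "(log_sum (\<lambda>l. f (Suc l)) a has_real_derivative ln \<bar>t\<bar> ^ a / fact a * (f 0 t / t)) (at t)"
    by (rule Suc.IH) (use Suc.prems in auto)
  have 2: "((\<lambda>t. ln \<bar>t\<bar> ^ Suc a / fact (Suc a) * f 0 t) has_real_derivative
      ln \<bar>t\<bar> ^ a / fact a / t * f 0 t + D * (ln \<bar>t\<bar> ^ Suc a / fact (Suc a))) (at t)"
    by (rule DERIV_mult[OF has_real_derivative_ln_abs_power[OF assms(1)] Suc.prems(1)])
  show ?case
    unfolding log_sum_Suc[abs_def] by (rule DERIV_cong[OF DERIV_diff[OF 2 1]]) simp
qed

text \<open>Here the derivatives of the \<open>f k\<close> cancel for \<open>a > 0\<close>, as they combine to \<open>(ln \<bar>t\<bar> - ln \<bar>t\<bar>) ^ a\<close>.\<close>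
lemma has_real_derivative_log_sum_cancel:
  assumes "t \<noteq> 0"
    and "\<And>k. (f k has_real_derivative ln \<bar>t\<bar> ^ k / fact k * c) (at t)"
  shows "(log_sum f a has_real_derivative (if a = 0 then c else log_sum f (a - 1) t / t)) (at t)"
proof (cases a)
  case 0
  moreover have "log_sum f 0 = f 0"
    by (rule ext) (simp add: log_sum_def)
  ultimately show ?thesis using assms(2)[of 0] by simp
next
  case (Suc b)
  define g where "g = (\<lambda>k (t :: real). (- 1) ^ k * (ln \<bar>t\<bar> ^ (a - k) / fact (a - k)))"
  \<comment> \<open>The weight at \<open>k = a\<close> is constant, so its derivative is 0; the
    surviving terms \<open>k <= b\<close> make up \<open>log_sum f b\<close> divided by t.\<close>
  define g' where "g' = (\<lambda>k :: nat. if k = a then 0 else (- 1) ^ k * (ln \<bar>t\<bar> ^ (b - k) / fact (b - k) / t))"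
  have g: "(g k has_real_derivative g' k) (at t)" if "k \<le> a" for k
  proof (cases "k = a")
    case False
    then have "a - k = Suc (b - k)" using that Suc by simp
    then show ?thesis
      using False DERIV_cmult[OF has_real_derivative_ln_abs_power[OF assms(1), of "b - k"], of "(- 1) ^ k"]
      unfolding g_def g'_def by (simp only: if_False)
  qed (simp add: g_def g'_def)
  have "log_sum f a = (\<lambda>t. \<Sum>k\<le>a. g k t * f k t)"
    by (rule ext) (simp add: log_sum_def g_def)
  moreover have "((\<lambda>t. \<Sum>k\<le>a. g k t * f k t) has_real_derivative
      (\<Sum>k\<le>a. g' k * f k t + ln \<bar>t\<bar> ^ k / fact k * c * g k t)) (at t)"
    by (intro DERIV_sum DERIV_mult g assms(2)) auto
  moreover have "(\<Sum>k\<le>a. g' k * f k t) = log_sum f b t / t"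
    by (simp add: Suc g'_def log_sum_def sum_divide_distrib)
  moreover have "(\<Sum>k\<le>a. ln \<bar>t\<bar> ^ k / fact k * c * g k t) = 0"
  proof -
    have "(\<Sum>k\<le>a. ln \<bar>t\<bar> ^ k / fact k * c * g k t)
        = c * ln \<bar>t\<bar> ^ a / fact a * (\<Sum>k\<le>a. (- 1) ^ k * real (a choose k))"
      unfolding sum_distrib_left
    proof (intro sum.cong refl)
      fix k assume "k \<in> {..a}"
      then have k: "k \<le> a" by simp
      then have "ln \<bar>t\<bar> ^ a = ln \<bar>t\<bar> ^ k * ln \<bar>t\<bar> ^ (a - k)"
        by (simp flip: power_add)
      then show "ln \<bar>t\<bar> ^ k / fact k * c * g k t = c * ln \<bar>t\<bar> ^ a / fact a * ((- 1) ^ k * real (a choose k))"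
        by (simp add: g_def binomial_fact[OF k])
    qed
    also have "(\<Sum>k\<le>a. (- 1) ^ k * real (a choose k)) = 0"
      using Suc by (intro choose_alternating_sum) simp
    finally show ?thesis by simp
  qed
  ultimately show ?thesis
    by (simp add: sum.distrib Suc)
qed

text \<open>The expression in braces of the formula. Raising l integrates both of its terms against
  dy / y, so the family in l satisfies the chain condition of
  \<open>has_real_derivative_log_sum_chain\<close>.\<close>

definition polylog_pair :: "nat \<Rightarrow> nat \<Rightarrow> nat \<Rightarrow> real \<Rightarrow> real" where
  "polylog_pair m j l y = mult_polylog ((l + 2) # replicate j 1) y
     + real m * mult_polylog ((l + 1) # replicate (j + 1) 1) y"

definition polylog_sum :: "nat \<Rightarrow> nat \<Rightarrow> real \<Rightarrow> real" where
  "polylog_sum m k y = (\<Sum>j\<le>k. real (j + 1) * real m ^ (j + 1) * log_sum (polylog_pair m j) (k - j) y)"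

lemma has_real_derivative_polylog_pair_Suc:
  assumes "\<bar>y\<bar> < 1" "y \<noteq> 0"
  shows "(polylog_pair m j (Suc l) has_real_derivative polylog_pair m j l y / y) (at y)"
proof -
  have 1: "(mult_polylog (Suc (l + 2) # replicate j 1) has_real_derivative mult_polylog ((l + 2) # replicate j 1) y / y) (at y)"
    by (rule has_real_derivative_mult_polylog_Suc) (use assms in auto)
  have 2: "(mult_polylog (Suc (l + 1) # replicate (j + 1) 1) has_real_derivative mult_polylog ((l + 1) # replicate (j + 1) 1) y / y) (at y)"
    by (rule has_real_derivative_mult_polylog_Suc) (use assms in auto)
  show ?thesis
    using DERIV_add[OF 1 DERIV_cmult[OF 2, of "real m"]]
    unfolding polylog_pair_def[abs_def] by (simp add: add_divide_distrib)
qed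

text \<open>Both terms differentiate to the polylogarithm of j + 1 ones, with weights 1 / y and m /
  (1 - y). The bracket is the derivative of ln |y| - m ln (1 - y), that is, of ln |z| once y = 1 -
  G(z).\<close>

lemma has_real_derivative_polylog_pair_0:
  assumes "\<bar>y\<bar> < 1" "y \<noteq> 0"
  shows "(polylog_pair m j 0 has_real_derivative
    (- ln (1 - y)) ^ (j + 1) / fact (j + 1) * (1 / y + real m / (1 - y))) (at y)"
proof -
  have 1: "(mult_polylog (Suc 1 # replicate j 1) has_real_derivative mult_polylog (1 # replicate j 1) y / y) (at y)"
    by (rule has_real_derivative_mult_polylog_Suc) (use assms in auto)
  have 2: "(mult_polylog (1 # replicate (j + 1) 1) has_real_derivative mult_polylog (replicate (j + 1) 1) y / (1 - y)) (at y)"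
    by (rule has_real_derivative_mult_polylog_1) (use assms in auto)
  have "mult_polylog (replicate (j + 1) 1) y = (- ln (1 - y)) ^ (j + 1) / fact (j + 1)"
    by (rule mult_polylog_ones[OF assms(1)])
  then have "mult_polylog (1 # replicate j 1) y / y + real m * (mult_polylog (replicate (j + 1) 1) y / (1 - y))
      = (- ln (1 - y)) ^ (j + 1) / fact (j + 1) * (1 / y + real m / (1 - y))"
    by (simp add: distrib_left)
  moreover have "polylog_pair m j 0 = (\<lambda>y. mult_polylog (Suc 1 # replicate j 1) y + real m * mult_polylog (1 # replicate (j + 1) 1) y)"
    by (simp add: polylog_pair_def[abs_def] numeral_2_eq_2)
  ultimately show ?thesis
    using DERIV_add[OF 1 DERIV_cmult[OF 2, of "real m"]] by metis
qed

text \<open>The weight j + 1 reduces the factorial of j + 1 to that of j. With the powers of m this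
  makes the sum over j a binomial expansion of (ln |y| - m ln (1 - y))^k.\<close>

lemma has_real_derivative_polylog_sum:
  assumes "\<bar>y\<bar> < 1" "y \<noteq> 0"
  shows "(polylog_sum m k has_real_derivative
    (ln \<bar>y\<bar> - real m * ln (1 - y)) ^ k / fact k * (- (real m * ln (1 - y))) * (1 / y + real m / (1 - y))) (at y)"
proof -
  define w where "w = 1 / y + real m / (1 - y)"
  define L where "L = - ln (1 - y)"
  have "(polylog_sum m k has_real_derivative
      (\<Sum>j\<le>k. real (j + 1) * real m ^ (j + 1) * (ln \<bar>y\<bar> ^ (k - j) / fact (k - j) * (L ^ (j + 1) / fact (j + 1) * w)))) (at y)"
    unfolding polylog_sum_def[abs_def] L_def w_def
    by (intro DERIV_sum DERIV_cmult has_real_derivative_log_sum_chain has_real_derivative_polylog_pair_Suc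
        has_real_derivative_polylog_pair_0 assms)
  also have "(\<Sum>j\<le>k. real (j + 1) * real m ^ (j + 1) * (ln \<bar>y\<bar> ^ (k - j) / fact (k - j) * (L ^ (j + 1) / fact (j + 1) * w)))
      = real m * L * w / fact k * (\<Sum>j\<le>k. real (k choose j) * (real m * L) ^ j * ln \<bar>y\<bar> ^ (k - j))"
    unfolding sum_distrib_left
  proof (intro sum.cong refl)
    fix j assume "j \<in> {..k}"
    then have j: "j \<le> k" by simp
    define r where "r = real (j + 1)"
    have r: "r \<noteq> 0" by (simp add: r_def)
    have f: "fact (j + 1) = real (j + 1) * fact j" by simp
    show "real (j + 1) * real m ^ (j + 1) * (ln \<bar>y\<bar> ^ (k - j) / fact (k - j) * (L ^ (j + 1) / fact (j + 1) * w))
      = real m * L * w / fact k * (real (k choose j) * (real m * L) ^ j * ln \<bar>y\<bar> ^ (k - j))"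
      unfolding f binomial_fact[OF j] r_def[symmetric] using r by (simp add: power_mult_distrib mult_ac)
  qed
  also have "(\<Sum>j\<le>k. real (k choose j) * (real m * L) ^ j * ln \<bar>y\<bar> ^ (k - j)) = (real m * L + ln \<bar>y\<bar>) ^ k"
    by (rule binomial_ring[symmetric])
  finally show ?thesis
    by (rule DERIV_cong) (simp add: L_def w_def)
qed

lemma polylog_sum_0 [simp]: "polylog_sum m k 0 = 0"
  by (simp add: polylog_sum_def log_sum_def polylog_pair_def)

section \<open>The Fuss--Catalan series up to the boundary of its disc of convergence\<close>

text \<open>The term for \<open>n = 0\<close> is \<open>1 / 0 = 0\<close>.\<close>
definition binomial_power_series :: "nat \<Rightarrow> nat \<Rightarrow> real \<Rightarrow> real" where
  "binomial_power_series m p z = (\<Sum>n. real (m * n choose n) / real n ^ Suc p * z ^ n)"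

context
  fixes m :: nat and \<rho> :: real
  assumes m: "m > 1"
  defines "\<rho> \<equiv> real (m - 1) ^ (m - 1) / real m ^ m"
begin

lemma rho_pos: "\<rho> > 0"
  using m by (simp add: \<rho>_def)

text \<open>The term \<open>k = n\<close> in the binomial expansion of \<open>(1 / m + (m - 1) / m) ^ (m * n) = 1\<close>.\<close>
lemma binomial_mult_rho_le_1: "real (m * n choose n) * \<rho> ^ n \<le> 1"
proof -
  define p q where "p = 1 / real m" and "q = real (m - 1) / real m"
  have pq: "p + q = 1" "p \<ge> 0" "q \<ge> 0"
    using m by (auto simp: p_def q_def of_nat_diff field_simps)
  have \<rho>: "\<rho> = p * q ^ (m - 1)"
    using m by (cases m) (auto simp: \<rho>_def p_def q_def power_divide)
  have "n \<le> m * n" "m * n - n = (m - 1) * n"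
    using m by (auto simp: diff_mult_distrib)
  then have "real (m * n choose n) * \<rho> ^ n = real (m * n choose n) * p ^ n * q ^ (m * n - n)"
    by (simp add: \<rho> power_mult_distrib power_mult)
  also have "\<dots> \<le> (\<Sum>k\<le>m * n. real (m * n choose k) * p ^ k * q ^ (m * n - k))"
    using pq \<open>n \<le> m * n\<close> by (intro member_le_sum[where f = "\<lambda>k. real (m * n choose k) * p ^ k * q ^ (m * n - k)"]) auto
  also have "\<dots> = (p + q) ^ (m * n)"
    by (rule binomial_ring[symmetric])
  finally show ?thesis
    by (simp add: pq)
qed

lemma summable_rho:
  assumes "\<And>n. \<bar>a n\<bar> \<le> real (m * n choose n)" "\<bar>z\<bar> < \<rho>"
  shows "summable (\<lambda>n. a n * z ^ n)"
proof (rule summable_comparison_test')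
  show "summable (\<lambda>n. (\<bar>z\<bar> / \<rho>) ^ n)"
    using assms(2) rho_pos by (intro summable_geometric) (auto simp: field_simps)
  fix n :: nat assume "n \<ge> 0"
  have "norm (a n * z ^ n) \<le> real (m * n choose n) * \<bar>z\<bar> ^ n"
    using assms(1)[of n] by (auto simp: abs_mult power_abs intro!: mult_right_mono)
  also have "\<dots> = (real (m * n choose n) * \<rho> ^ n) * (\<bar>z\<bar> / \<rho>) ^ n"
    using rho_pos by (simp add: power_divide)
  also have "\<dots> \<le> 1 * (\<bar>z\<bar> / \<rho>) ^ n"
    using rho_pos by (intro mult_right_mono binomial_mult_rho_le_1) auto
  finally show "norm (a n * z ^ n) \<le> (\<bar>z\<bar> / \<rho>) ^ n" by simp
qed

lemma fps_conv_radius_ge_rho: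
  assumes "\<And>n. \<bar>fps_nth f n\<bar> \<le> real (m * n choose n)"
  shows "fps_conv_radius f \<ge> ereal \<rho>"
  unfolding fps_conv_radius_def
  by (rule conv_radius_geI_ex') (use assms in \<open>auto intro!: summable_rho\<close>)

lemma fc_fps_nth_nonneg: "fps_nth (fc_fps m) n \<ge> 0"
  by (simp add: fc_fps_def)

lemma fc_fps_nth_le: "\<bar>fps_nth (fc_fps m) n\<bar> \<le> real (m * n choose n)"
proof -
  have "real (m * n choose n) / real ((m - 1) * n + 1) \<le> real (m * n choose n) / 1"
    by (rule divide_left_mono) (auto intro!: add_pos_nonneg)
  then show ?thesis by (simp add: fc_fps_def)
qed

lemma divide_power_nat_le: "real c / real n ^ Suc p \<le> real c"
proof (cases "n = 0")
  case False
  then have "1 \<le> real n ^ Suc p" by (intro one_le_power) auto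
  then have "real c / real n ^ Suc p \<le> real c / 1" by (intro divide_left_mono) auto
  then show ?thesis by simp
qed simp

lemma fc_log_fps_nth_le: "\<bar>fps_nth (fc_log_fps m) n\<bar> \<le> real (m * n choose n)"
  using divide_power_nat_le[of "m * n choose n" n 0] by (simp add: fc_log_fps_def)

lemma fuss_catalan_gf_eval: "fuss_catalan_gf m = eval_fps (fc_fps m)"
  by (rule ext) (simp add: fuss_catalan_gf_def eval_fps_def fc_fps_def)

lemma conv_radius_fc:
  assumes "\<bar>z\<bar> < \<rho>"
  shows "ereal (norm z) < fps_conv_radius (fc_fps m)" "ereal (norm z) < fps_conv_radius (fc_log_fps m)"
proof -
  have "ereal (norm z) < ereal \<rho>" using assms by simp
  then show "ereal (norm z) < fps_conv_radius (fc_fps m)" "ereal (norm z) < fps_conv_radius (fc_log_fps m)"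
    using fps_conv_radius_ge_rho fc_fps_nth_le fc_log_fps_nth_le by (blast intro: less_le_trans)+
qed

lemma fuss_catalan_gf_0 [simp]: "fuss_catalan_gf m 0 = 1"
  by (simp add: fuss_catalan_gf_eval eval_fps_at_0 fc_fps_def)

lemma fuss_catalan_gf_eq:
  assumes "\<bar>z\<bar> < \<rho>"
  shows "fuss_catalan_gf m z = 1 + z * fuss_catalan_gf m z ^ m"
proof -
  have 1: "ereal (norm z) < fps_conv_radius (fc_fps m ^ m)"
    using conv_radius_fc(1)[OF assms] fps_conv_radius_power less_le_trans by blast
  have "ereal (norm z) < min (fps_conv_radius fps_X) (fps_conv_radius (fc_fps m ^ m))"
    using 1 by simp
  then have 2: "ereal (norm z) < fps_conv_radius (fps_X * fc_fps m ^ m)"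
    using fps_conv_radius_mult less_le_trans by blast
  have "eval_fps (fc_fps m) z = eval_fps (1 + fps_X * fc_fps m ^ m) z"
    using fc_fps_eq[OF m] by simp
  also have "\<dots> = 1 + z * eval_fps (fc_fps m) z ^ m"
    using 1 2 conv_radius_fc(1)[OF assms] by (simp add: eval_fps_add eval_fps_mult eval_fps_power)
  finally show ?thesis
    by (simp add: fuss_catalan_gf_eval)
qed

lemma fuss_catalan_gf_deriv_ex:
  assumes "\<bar>z\<bar> < \<rho>"
  shows "(fuss_catalan_gf m has_real_derivative eval_fps (fps_deriv (fc_fps m)) z) (at z within A)"
  unfolding fuss_catalan_gf_eval
  by (rule has_field_derivative_eval_fps) (use conv_radius_fc(1)[OF assms] in simp)

lemma continuous_on_fuss_catalan_gf_open: "continuous_on {- \<rho><..<\<rho>} (fuss_catalan_gf m)"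
  by (rule DERIV_continuous_on, rule fuss_catalan_gf_deriv_ex) auto

text \<open>The image of the open interval is connected and contains G(0) = 1, so it suffices that
  two values are never taken. G = 0 contradicts the functional equation. The value m / (m-1) is the
  critical point of (G - 1) / G^m, and the functional equation would force z = \<open>\<rho>\<close>
  there.\<close>

lemma fuss_catalan_gf_bounds_open:
  assumes "\<bar>z\<bar> < \<rho>"
  shows "0 < fuss_catalan_gf m z" "fuss_catalan_gf m z < real m / real (m - 1)"
proof -
  let ?G = "fuss_catalan_gf m"
  have conn: "connected (?G ` {- \<rho><..<\<rho>})"
    by (intro connected_continuous_image continuous_on_fuss_catalan_gf_open) simp
  have mem: "?G 0 \<in> ?G ` {- \<rho><..<\<rho>}" "?G z \<in> ?G ` {- \<rho><..<\<rho>}"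
    using assms rho_pos by (auto intro!: imageI simp del: fuss_catalan_gf_0)
  show "0 < ?G z"
  proof (rule ccontr)
    assume "\<not> 0 < ?G z"
    then have "0 \<in> ?G ` {- \<rho><..<\<rho>}"
      using connectedD_interval[OF conn mem(2,1), of 0] by simp
    then obtain w where "w \<in> {- \<rho><..<\<rho>}" "?G w = 0"
      by (metis imageE)
    moreover from this have "\<bar>w\<bar> < \<rho>" by auto
    ultimately show False
      using fuss_catalan_gf_eq[of w] m by (simp add: zero_power)
  qed
  show "?G z < real m / real (m - 1)"
  proof (rule ccontr)
    assume *: "\<not> ?G z < real m / real (m - 1)"
    have "1 \<le> real m / real (m - 1)" using m by simp
    then have "real m / real (m - 1) \<in> ?G ` {- \<rho><..<\<rho>}"
      using connectedD_interval[OF conn mem, of "real m / real (m - 1)"] * by simp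
    then obtain w where "w \<in> {- \<rho><..<\<rho>}" and Gw: "?G w = real m / real (m - 1)"
      by (metis imageE)
    then have w: "\<bar>w\<bar> < \<rho>" by auto
    then have "w * (real m / real (m - 1)) ^ m = real m / real (m - 1) - 1"
      using fuss_catalan_gf_eq[OF w] Gw by simp
    also have "\<dots> = 1 / real (m - 1)"
      using m by (simp add: of_nat_diff field_simps)
    finally have "w = 1 / real (m - 1) / (real m / real (m - 1)) ^ m"
      using m by (simp add: divide_simps mult_ac)
    also have "\<dots> = \<rho>"
      using m by (cases m) (auto simp: \<rho>_def power_divide)
    finally show False using w by simp
  qed
qed

lemma fuss_catalan_gf_le_2_open: "\<bar>z\<bar> < \<rho> \<Longrightarrow> fuss_catalan_gf m z \<le> 2"
proof -
  assume "\<bar>z\<bar> < \<rho>"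
  then have "fuss_catalan_gf m z < real m / real (m - 1)" by (rule fuss_catalan_gf_bounds_open)
  also have "\<dots> \<le> 2" using m by (simp add: of_nat_diff field_simps)
  finally show ?thesis by simp
qed

text \<open>The coefficients are nonnegative and the sum is bounded by \<open>2\<close> inside the disc, so the series
  converges at \<open>\<rho>\<close> and hence uniformly up to the boundary.\<close>
lemma summable_fc_rho: "summable (\<lambda>n. fps_nth (fc_fps m) n * \<rho> ^ n)"
proof (rule summableI_nonneg_bounded)
  show "0 \<le> fps_nth (fc_fps m) n * \<rho> ^ n" for n
    using rho_pos by (simp add: fc_fps_nth_nonneg)
  fix N
  show "(\<Sum>n<N. fps_nth (fc_fps m) n * \<rho> ^ n) \<le> 2"
  proof (rule tendsto_upperbound)
    show "((\<lambda>z. \<Sum>n<N. fps_nth (fc_fps m) n * z ^ n) \<longlongrightarrow> (\<Sum>n<N. fps_nth (fc_fps m) n * \<rho> ^ n)) (at_left \<rho>)"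
      by (intro tendsto_intros)
    have "eventually (\<lambda>z. z \<in> {0<..<\<rho>}) (at_left \<rho>)"
      using rho_pos by (rule eventually_at_left_real)
    then show "eventually (\<lambda>z. (\<Sum>n<N. fps_nth (fc_fps m) n * z ^ n) \<le> 2) (at_left \<rho>)"
    proof eventually_elim
      case (elim z)
      have "(\<Sum>n<N. fps_nth (fc_fps m) n * z ^ n) \<le> fuss_catalan_gf m z"
        unfolding fuss_catalan_gf_eval eval_fps_def using elim
        by (intro sum_le_suminf summable_rho fc_fps_nth_le) (auto simp: fc_fps_nth_nonneg)
      also have "\<dots> \<le> 2" using elim by (intro fuss_catalan_gf_le_2_open) auto
      finally show ?case .
    qed
  qed simp
qed

lemma continuous_on_fuss_catalan_gf: "continuous_on {- \<rho>..\<rho>} (fuss_catalan_gf m)"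
  unfolding fuss_catalan_gf_eval eval_fps_def
  using summable_fc_rho by (intro continuous_on_powser_abs) (simp add: fc_fps_nth_nonneg)

text \<open>The functional equation and weak bounds pass to the closure by continuity; strict
  positivity is recovered because G = 0 contradicts the equation. The bounds put 1 - G(z) into [-1,
  1), where the polylogarithm series converge.\<close>

lemma fuss_catalan_gf_closed:
  assumes "\<bar>z\<bar> \<le> \<rho>"
  shows fuss_catalan_gf_eq_closed: "fuss_catalan_gf m z = 1 + z * fuss_catalan_gf m z ^ m"
    and fuss_catalan_gf_pos: "0 < fuss_catalan_gf m z"
    and fuss_catalan_gf_le_2: "fuss_catalan_gf m z \<le> 2"
proof -
  let ?G = "fuss_catalan_gf m"
  have cl: "closure {- \<rho><..<\<rho>} = {- \<rho>..\<rho>}"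
    using rho_pos by simp
  have z: "z \<in> closure {- \<rho><..<\<rho>}"
    unfolding cl using assms by auto
  have "?G z - (1 + z * ?G z ^ m) = 0"
  proof (rule continuous_constant_on_closure[OF _ _ z])
    show "continuous_on (closure {- \<rho><..<\<rho>}) (\<lambda>z. ?G z - (1 + z * ?G z ^ m))"
      unfolding cl by (intro continuous_intros continuous_on_fuss_catalan_gf)
    show "?G w - (1 + w * ?G w ^ m) = 0" if "w \<in> {- \<rho><..<\<rho>}" for w
      using fuss_catalan_gf_eq[of w] that by auto
  qed
  then show eq: "?G z = 1 + z * ?G z ^ m" by simp
  have "?G z \<ge> 0"
    by (rule continuous_ge_on_closure[OF _ z])
      (auto simp: cl intro!: continuous_on_fuss_catalan_gf less_imp_le fuss_catalan_gf_bounds_open)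
  moreover have "?G z \<noteq> 0"
    using eq m by (auto simp: zero_power)
  ultimately show "0 < ?G z" by simp
  show "?G z \<le> 2"
    by (rule continuous_le_on_closure[OF _ z])
      (auto simp: cl intro!: continuous_on_fuss_catalan_gf fuss_catalan_gf_le_2_open)
qed

text \<open>This is the logarithmic derivative of 1 - G = - z G^m. It is the form in which the chain
  rule for y = 1 - G(z) turns the factor 1 / y + m / (1 - y) into 1 / z.\<close>

lemma fuss_catalan_gf_has_derivative:
  assumes "\<bar>z\<bar> < \<rho>" "z \<noteq> 0"
  obtains G' where "(fuss_catalan_gf m has_real_derivative G') (at z)"
    "- G' * (1 / (1 - fuss_catalan_gf m z) + real m / fuss_catalan_gf m z) = 1 / z"
proof -
  define G where "G = fuss_catalan_gf m z"
  define G' where "G' = eval_fps (fps_deriv (fc_fps m)) z"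
  have d: "(fuss_catalan_gf m has_real_derivative G') (at z)"
    unfolding G'_def using assms(1) by (rule fuss_catalan_gf_deriv_ex)
  have "((\<lambda>z. 1 + z * fuss_catalan_gf m z ^ m) has_real_derivative G ^ m + z * (real m * (G' * G ^ (m - 1)))) (at z)"
    by (rule derivative_eq_intros d refl)+ (simp add: G_def mult_ac)
  moreover have "((\<lambda>z. 1 + z * fuss_catalan_gf m z ^ m) has_real_derivative G') (at z)"
    using d
  proof (rule has_field_derivative_transform_within_open)
    show "fuss_catalan_gf m w = 1 + w * fuss_catalan_gf m w ^ m" if "w \<in> {- \<rho><..<\<rho>}" for w
      using that by (intro fuss_catalan_gf_eq) auto
  qed (use assms in auto)
  ultimately have G': "G' = G ^ m + z * (real m * (G' * G ^ (m - 1)))"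
    by (metis DERIV_unique)
  have G: "G > 0" "1 - G = - z * G ^ m"
    using fuss_catalan_gf_bounds_open[OF assms(1)] fuss_catalan_gf_eq[OF assms(1)] by (auto simp: G_def)
  have Gm: "G ^ m = G * G ^ (m - 1)"
    using m by (cases m) auto
  have "- G' * (1 / (1 - G) + real m / G) = (G' - z * (real m * (G' * G ^ (m - 1)))) / (z * G ^ m)"
    using G(1) assms(2) unfolding G(2) Gm by (simp add: field_simps)
  also have "G' - z * (real m * (G' * G ^ (m - 1))) = G ^ m"
    using G' by linarith
  also have "G ^ m / (z * G ^ m) = 1 / z"
    using G(1) by simp
  finally show ?thesis
    using that d unfolding G_def by blast
qed

text \<open>Evaluating the formal derivative identity shows that both sides have the same
  derivative. Both vanish at 0, as the term n = 0 of the series is 0 and G(0) = 1.\<close>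

lemma binomial_power_series_0:
  assumes "\<bar>z\<bar> < \<rho>"
  shows "binomial_power_series m 0 z = real m * ln (fuss_catalan_gf m z)"
proof -
  let ?G = "fuss_catalan_gf m" and ?D = "eval_fps (fc_log_fps m)"
  let ?f = "\<lambda>z. ?D z - real m * ln (?G z)"
  have "\<exists>c. \<forall>x\<in>{- \<rho><..<\<rho>}. ?f x = c"
  proof (rule has_field_derivative_zero_constant)
    show "(?f has_real_derivative 0) (at x within {- \<rho><..<\<rho>})" if "x \<in> {- \<rho><..<\<rho>}" for x
    proof -
      have x: "\<bar>x\<bar> < \<rho>" using that by auto
      define G' where "G' = eval_fps (fps_deriv (fc_fps m)) x"
      define D' where "D' = eval_fps (fps_deriv (fc_log_fps m)) x"
      have G': "(?G has_real_derivative G') (at x within {- \<rho><..<\<rho>})"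
        unfolding G'_def by (rule fuss_catalan_gf_deriv_ex[OF x])
      have D': "(?D has_real_derivative D') (at x within {- \<rho><..<\<rho>})"
        unfolding D'_def by (rule has_field_derivative_eval_fps) (use conv_radius_fc(2)[OF x] in simp)
      have r: "ereal (norm x) < fps_conv_radius (fps_deriv (fc_fps m))"
        "ereal (norm x) < fps_conv_radius (fps_deriv (fc_log_fps m))"
        using conv_radius_fc[OF x] fps_conv_radius_deriv less_le_trans by blast+
      have "D' * ?G x = real m * G'"
        using arg_cong[OF fc_log_fps_deriv[OF m], of "\<lambda>f. eval_fps f x"] r conv_radius_fc[OF x]
        by (simp add: eval_fps_mult D'_def G'_def fuss_catalan_gf_eval)
      then show ?thesis
        using fuss_catalan_gf_bounds_open[OF x]
        by (auto intro!: derivative_eq_intros G' D' simp: field_simps)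
    qed
  qed auto
  then obtain c where c: "\<forall>x\<in>{- \<rho><..<\<rho>}. ?f x = c" ..
  have "?f z = c"
    by (rule bspec[OF c]) (use assms in auto)
  moreover have "?f 0 = c"
    by (rule bspec[OF c]) (use rho_pos in auto)
  ultimately have "?D z = real m * ln (?G z)"
    by (simp add: eval_fps_at_0 fc_log_fps_def)
  then show ?thesis
    by (simp add: binomial_power_series_def eval_fps_def fc_log_fps_def)
qed

section \<open>Derivatives and boundary convergence of the binomial power series\<close>

lemma binomial_power_series_at_0 [simp]: "binomial_power_series m p 0 = 0"
  unfolding binomial_power_series_def by (subst powser_zero) simp

lemma binomial_power_series_deriv:
  assumes "\<bar>z\<bar> < \<rho>" "z \<noteq> 0"
  shows "(binomial_power_series m (Suc p) has_real_derivative binomial_power_series m p z / z) (at z)"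
proof -
  let ?a = "\<lambda>p n. real (m * n choose n) / real n ^ Suc p"
  have a: "\<bar>?a p n\<bar> \<le> real (m * n choose n)" for p n
    using divide_power_nat_le[of "m * n choose n" n p] by simp
  have "(\<lambda>n. ?a p n * z ^ n) sums binomial_power_series m p z"
    unfolding binomial_power_series_def by (intro summable_sums summable_rho a assms)
  then have "(\<lambda>n. ?a p (Suc n) * z ^ Suc n) sums binomial_power_series m p z"
    by (subst sums_Suc_iff) simp
  then have "(\<lambda>n. ?a p (Suc n) * z ^ Suc n / z) sums (binomial_power_series m p z / z)"
    by (rule sums_divide)
  then have "(\<lambda>n. diffs (?a (Suc p)) n * z ^ n) sums (binomial_power_series m p z / z)"
    using assms by (simp add: diffs_def del: of_nat_Suc)
  moreover have "(binomial_power_series m (Suc p) has_real_derivative (\<Sum>n. diffs (?a (Suc p)) n * z ^ n)) (at z)"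
    unfolding binomial_power_series_def[abs_def]
    using assms by (intro termdiffs_strong'[where K = \<rho>] summable_rho a) auto
  ultimately show ?thesis
    by (simp add: sums_iff)
qed

text \<open>At the boundary the binomial coefficient times \<open>\<rho> ^ n\<close> is at most 1,
  so the exponent \<open>Suc (Suc p)\<close>, at least 2, gives convergence. Hence the statements on
  the closed interval start at index \<open>Suc p\<close>.\<close>

lemma summable_binomial_power_series_rho:
  "summable (\<lambda>n. \<bar>real (m * n choose n) / real n ^ Suc (Suc p)\<bar> * \<rho> ^ n)"
proof (rule summable_comparison_test')
  show "summable (\<lambda>n. inverse (real n ^ Suc (Suc p)))"
    by (rule inverse_power_summable) simp
  fix n :: nat
  have "real (m * n choose n) * \<rho> ^ n * inverse (real n ^ Suc (Suc p)) \<le> 1 * inverse (real n ^ Suc (Suc p))"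
    by (intro mult_right_mono binomial_mult_rho_le_1) auto
  then show "norm (\<bar>real (m * n choose n) / real n ^ Suc (Suc p)\<bar> * \<rho> ^ n) \<le> inverse (real n ^ Suc (Suc p))"
    using rho_pos by (simp add: abs_mult divide_inverse mult_ac)
qed

lemma continuous_on_binomial_power_series: "continuous_on {- \<rho>..\<rho>} (binomial_power_series m (Suc p))"
  unfolding binomial_power_series_def[abs_def]
  by (rule continuous_on_powser_abs[OF summable_binomial_power_series_rho])

lemma binomial_power_series_sums:
  assumes "\<bar>z\<bar> \<le> \<rho>"
  shows "(\<lambda>n. real (m * Suc n choose Suc n) * z ^ Suc n / real (Suc n) ^ Suc (Suc p)) sums binomial_power_series m (Suc p) z"
proof -
  have "summable (\<lambda>n. real (m * n choose n) / real n ^ Suc (Suc p) * z ^ n)"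
  proof (rule summable_comparison_test'[OF summable_binomial_power_series_rho])
    show "norm (real (m * n choose n) / real n ^ Suc (Suc p) * z ^ n)
        \<le> \<bar>real (m * n choose n) / real n ^ Suc (Suc p)\<bar> * \<rho> ^ n" for n
      unfolding norm_mult norm_power using assms by (intro mult_mono power_mono) auto
  qed
  then have "(\<lambda>n. real (m * n choose n) / real n ^ Suc (Suc p) * z ^ n) sums binomial_power_series m (Suc p) z"
    unfolding binomial_power_series_def by (rule summable_sums)
  then have "(\<lambda>n. real (m * Suc n choose Suc n) / real (Suc n) ^ Suc (Suc p) * z ^ Suc n) sums binomial_power_series m (Suc p) z"
    by (subst sums_Suc_iff) simp
  then show ?thesis
    by (simp only: times_divide_eq_left)
qed

section \<open>Continuity of the right-hand side on the closed interval\<close>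

lemma continuous_on_ln_ln_polylog:
  assumes "0 \<notin> set ks" "k > 0"
  shows "continuous_on {- \<rho>..\<rho>}
    (\<lambda>z. ln \<bar>z\<bar> ^ a * (ln \<bar>1 - fuss_catalan_gf m z\<bar> ^ b * mult_polylog (k # ks) (1 - fuss_catalan_gf m z)))"
proof -
  txt \<open>Since \<open>y = 1 - G(z) = - z G(z)\<^sup>m\<close>, a factor \<open>y\<close> of the polylogarithm splits into square roots of
    \<open>z\<close> and \<open>y\<close>, each of which absorbs the powers of its own logarithm.\<close>
  let ?y = "\<lambda>z. 1 - fuss_catalan_gf m z"
  obtain H where H: "continuous_on {- 1..<1} H" "\<And>y. y \<in> {- 1..<1} \<Longrightarrow> mult_polylog (k # ks) y = y * H y"
    using mult_polylog_factor[OF assms] by blast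
  have y: "?y z \<in> {- 1..<1}" if "z \<in> {- \<rho>..\<rho>}" for z
    using fuss_catalan_gf_closed(2,3)[of z] that by auto
  note cont_G = continuous_on_fuss_catalan_gf
  have 1: "continuous_on {- \<rho>..\<rho>} (\<lambda>z. ln \<bar>\<bar>z\<bar>\<bar> ^ a * sqrt \<bar>z\<bar>)"
    by (rule continuous_on_compose2[OF continuous_on_ln_abs_power_sqrt]) (auto intro!: continuous_intros)
  have 2: "continuous_on {- \<rho>..\<rho>} (\<lambda>z. ln \<bar>?y z\<bar> ^ b * sqrt (?y z))"
    by (rule continuous_on_compose2[OF continuous_on_ln_abs_power_sqrt]) (auto intro!: continuous_intros cont_G)
  have 3: "continuous_on {- \<rho>..\<rho>} (\<lambda>z. sqrt (fuss_catalan_gf m z ^ m))"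
    by (intro continuous_intros cont_G)
  have 4: "continuous_on {- \<rho>..\<rho>} (\<lambda>z. H (?y z))"
    by (rule continuous_on_compose2[OF H(1)]) (use y in \<open>auto intro!: continuous_intros cont_G\<close>)
  note continuous_on_mult[OF 1 continuous_on_mult[OF 2 continuous_on_mult[OF 3 4]]]
  then show ?thesis
  proof (rule continuous_on_eq)
    fix z assume z: "z \<in> {- \<rho>..\<rho>}"
    define s where "s = sqrt (fuss_catalan_gf m z ^ m)"
    have G: "\<bar>z\<bar> \<le> \<rho>" using z by auto
    have s2: "s * s = fuss_catalan_gf m z ^ m"
      using fuss_catalan_gf_closed(2)[OF G] by (simp add: s_def)
    have yz: "?y z = - (z * fuss_catalan_gf m z ^ m)"
      using fuss_catalan_gf_closed(1)[OF G] by simp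
    \<comment> \<open>For negative z the odd extension gives \<open>sqrt z = - sqrt (- z)\<close>,
      so the product keeps the sign of z. The same oddness yields the minus sign in the formula for
      \<open>sqrt (?y z)\<close> below.\<close>
    have zz: "sqrt z * sqrt \<bar>z\<bar> = z"
      by (cases "z \<ge> 0") (auto simp: real_sqrt_minus)
    have "sqrt (?y z) = - (sqrt z * s)"
      by (simp only: yz real_sqrt_minus real_sqrt_mult s_def)
    then have "sqrt \<bar>z\<bar> * (sqrt (?y z) * s) = - ((sqrt z * sqrt \<bar>z\<bar>) * (s * s))"
      by simp
    also have "\<dots> = ?y z"
      unfolding zz s2 yz ..
    finally have *: "sqrt \<bar>z\<bar> * (sqrt (?y z) * s) = ?y z" .
    have "ln \<bar>\<bar>z\<bar>\<bar> ^ a * sqrt \<bar>z\<bar> * (ln \<bar>?y z\<bar> ^ b * sqrt (?y z) * (s * H (?y z)))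
        = ln \<bar>z\<bar> ^ a * (ln \<bar>?y z\<bar> ^ b * ((sqrt \<bar>z\<bar> * (sqrt (?y z) * s)) * H (?y z)))"
      by (simp only: abs_abs mult_ac)
    then show "ln \<bar>\<bar>z\<bar>\<bar> ^ a * sqrt \<bar>z\<bar> * (ln \<bar>?y z\<bar> ^ b * sqrt (?y z) * (sqrt (fuss_catalan_gf m z ^ m) * H (?y z)))
        = ln \<bar>z\<bar> ^ a * (ln \<bar>?y z\<bar> ^ b * mult_polylog (k # ks) (?y z))"
      unfolding s_def *[unfolded s_def] H(2)[OF y[OF z]] .
  qed
qed

lemma continuous_on_ln_polylog_sum:
  "continuous_on {- \<rho>..\<rho>} (\<lambda>z. ln \<bar>z\<bar> ^ a * polylog_sum m k (1 - fuss_catalan_gf m z))"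
proof -
  let ?y = "\<lambda>z. 1 - fuss_catalan_gf m z"
  define c where "c = (\<lambda>j l. real (j + 1) * real m ^ (j + 1) * ((- 1) ^ l / fact (k - j - l)))"
  have "(\<lambda>z. ln \<bar>z\<bar> ^ a * polylog_sum m k (?y z)) = (\<lambda>z. \<Sum>j\<le>k. \<Sum>l\<le>k - j.
      c j l * (ln \<bar>z\<bar> ^ a * (ln \<bar>?y z\<bar> ^ (k - j - l) * mult_polylog ((l + 2) # replicate j 1) (?y z)))
      + c j l * real m * (ln \<bar>z\<bar> ^ a * (ln \<bar>?y z\<bar> ^ (k - j - l) * mult_polylog ((l + 1) # replicate (j + 1) 1) (?y z))))"
    unfolding polylog_sum_def log_sum_def polylog_pair_def sum_distrib_left c_def
    by (intro ext sum.cong refl) (simp only: distrib_left mult_ac)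
  moreover have "continuous_on {- \<rho>..\<rho>} \<dots>"
    by (intro continuous_on_sum continuous_on_add continuous_on_mult_left continuous_on_ln_ln_polylog) auto
  ultimately show ?thesis by (simp only:)
qed

lemma continuous_on_log_sum_polylog_sum:
  "continuous_on {- \<rho>..\<rho>} (log_sum (\<lambda>k z. polylog_sum m k (1 - fuss_catalan_gf m z)) p)"
  unfolding log_sum_def[abs_def] mult.assoc
  by (intro continuous_on_sum continuous_on_mult_left continuous_on_ln_polylog_sum)

text \<open>Under y = 1 - G(z) every ingredient becomes a function of z: ln |y| - m ln (1 - y) is ln
  |z|, and the bracket times the derivative of y is 1 / z. The remaining factor does not depend on
  k, as \<open>has_real_derivative_log_sum_cancel\<close> requires.\<close>

lemma has_real_derivative_polylog_sum_gf:
  assumes "\<bar>z\<bar> < \<rho>" "z \<noteq> 0"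
  shows "((\<lambda>z. polylog_sum m k (1 - fuss_catalan_gf m z)) has_real_derivative
    ln \<bar>z\<bar> ^ k / fact k * (- (real m * ln (fuss_catalan_gf m z)) / z)) (at z)"
proof -
  define G where "G = fuss_catalan_gf m z"
  obtain G' where G': "(fuss_catalan_gf m has_real_derivative G') (at z)"
    "- G' * (1 / (1 - G) + real m / G) = 1 / z"
    using fuss_catalan_gf_has_derivative[OF assms] unfolding G_def by blast
  have G2: "G < real m / real (m - 1)" and G: "G > 0"
    using fuss_catalan_gf_bounds_open[OF assms(1)] by (simp_all add: G_def)
  have "real m / real (m - 1) \<le> 2"
    using m by (simp add: of_nat_diff field_simps)
  with G2 have "G < 2" by (rule less_le_trans)
  then have y1: "\<bar>1 - G\<bar> < 1" using G by (simp add: abs_less_iff)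
  have y: "1 - G = - (z * G ^ m)"
    using fuss_catalan_gf_eq[OF assms(1)] by (simp add: G_def)
  have y0: "1 - G \<noteq> 0"
    unfolding y using G assms by simp
  have "\<bar>1 - G\<bar> = \<bar>z\<bar> * G ^ m"
    unfolding y using G by (simp add: abs_mult)
  then have "ln \<bar>1 - G\<bar> = ln \<bar>z\<bar> + real m * ln G"
    using G assms by (simp add: ln_mult ln_realpow)
  then have L: "ln \<bar>1 - G\<bar> - real m * ln G = ln \<bar>z\<bar>" by simp
  have "(polylog_sum m k has_real_derivative
      ln \<bar>z\<bar> ^ k / fact k * (- (real m * ln G)) * (1 / (1 - G) + real m / G)) (at (1 - fuss_catalan_gf m z))"
    using has_real_derivative_polylog_sum[OF y1 y0, of m k] L by (simp add: G_def)
  moreover have "((\<lambda>z. 1 - fuss_catalan_gf m z) has_real_derivative - G') (at z)"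
    using DERIV_diff[OF DERIV_const G'(1)] by simp
  ultimately have "((\<lambda>z. polylog_sum m k (1 - fuss_catalan_gf m z)) has_real_derivative
      ln \<bar>z\<bar> ^ k / fact k * (- (real m * ln G)) * (1 / (1 - G) + real m / G) * - G') (at z)"
    by (rule DERIV_chain2)
  also have "ln \<bar>z\<bar> ^ k / fact k * (- (real m * ln G)) * (1 / (1 - G) + real m / G) * - G'
      = ln \<bar>z\<bar> ^ k / fact k * (- (real m * ln G)) * (- G' * (1 / (1 - G) + real m / G))"
    by (simp only: mult_ac)
  finally show ?thesis
    unfolding G'(2) by (simp add: G_def)
qed

text \<open>The sum \<open>E\<close> of the series and the candidate has derivative 0 away from the
  origin: for \<open>p = 0\<close> by the logarithmic series, otherwise by the induction hypothesis
  for \<open>p - 1\<close>. Continuity on the closed interval and \<open>E 0 = 0\<close> then finish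
  the proof.\<close>

lemma binomial_power_series_eq:
  assumes "\<bar>z\<bar> \<le> \<rho>"
  shows "binomial_power_series m (Suc p) z = - log_sum (\<lambda>k z. polylog_sum m k (1 - fuss_catalan_gf m z)) p z"
  using assms
proof (induction p arbitrary: z rule: less_induct)
  case IH: (less p)
  define U where "U = (\<lambda>k z. polylog_sum m k (1 - fuss_catalan_gf m z))"
  define E where "E = (\<lambda>z. binomial_power_series m (Suc p) z + log_sum U p z)"
  have cont: "continuous_on {- \<rho>..\<rho>} E"
    unfolding E_def U_def
    by (intro continuous_on_add continuous_on_binomial_power_series continuous_on_log_sum_polylog_sum)
  have deriv: "(E has_real_derivative 0) (at w)" if w: "\<bar>w\<bar> < \<rho>" "w \<noteq> 0" for w
  proof -
    define c where "c = - (real m * ln (fuss_catalan_gf m w)) / w"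
    have "(binomial_power_series m (Suc p) has_real_derivative binomial_power_series m p w / w) (at w)"
      using w by (rule binomial_power_series_deriv)
    moreover have "(log_sum U p has_real_derivative (if p = 0 then c else log_sum U (p - 1) w / w)) (at w)"
      using has_real_derivative_polylog_sum_gf[OF w] w(2)
      unfolding U_def c_def by (intro has_real_derivative_log_sum_cancel) auto
    ultimately have "(E has_real_derivative
        binomial_power_series m p w / w + (if p = 0 then c else log_sum U (p - 1) w / w)) (at w)"
      unfolding E_def by (rule DERIV_add)
    moreover have "binomial_power_series m p w / w + (if p = 0 then c else log_sum U (p - 1) w / w) = 0"
    proof (cases p)
      case 0
      then show ?thesis
        using binomial_power_series_0[OF w(1)] by (simp add: c_def)
    next
      case (Suc r)
      then have "binomial_power_series m p w = - log_sum U r w"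
        using IH.IH[of r w] w by (simp add: U_def)
      then show ?thesis by (simp add: Suc)
    qed
    ultimately show ?thesis by simp
  qed
  have E0: "E 0 = 0"
    by (simp add: E_def U_def log_sum_def)
  have "E z = E 0"
  \<comment> \<open>The derivative is known only for nonzero points of the open interval, so
    \<open>E\<close> is shown constant between 0 and z on either side; 0 and a boundary point z
    enter only as endpoints, where continuity suffices.\<close>
  proof (cases z "0 :: real" rule: linorder_cases)
    case less
    then have "E 0 = E z"
    proof (rule DERIV_isconst_end)
      show "continuous_on {z..0} E"
        using cont by (rule continuous_on_subset) (use IH.prems rho_pos in auto)
    qed (use deriv IH.prems in auto)
    then show ?thesis by simp
  next
    case greater
    then show ?thesis
    proof (rule DERIV_isconst_end)
      show "continuous_on {0..z} E"
        using cont by (rule continuous_on_subset) (use IH.prems rho_pos in auto)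
    qed (use deriv IH.prems in auto)
  qed simp
  then show ?case
    using E0 by (simp add: E_def U_def)
qed

end

theorem theorem5p2:
  fixes m p :: nat and x :: real
  assumes "m > 1" and "p > 0"
    and "0 < \<bar>x\<bar>" and "\<bar>x\<bar> \<le> real (m - 1) ^ (m - 1) / real m ^ m"
  shows "(\<lambda>n. real (m * Suc n choose Suc n) * (- x) ^ Suc n / real (Suc n) ^ (p + 1)) sums
    (- (\<Sum>k = 0..p - 1. \<Sum>(j, l) \<in> {(j, l). j + l \<le> k}.
         (- 1) ^ (l + k) * (real (j + 1) * real m ^ (j + 1) / (fact (p - 1 - k) * fact (k - j - l)))
         * ln \<bar>x\<bar> ^ (p - 1 - k) * ln \<bar>1 - fuss_catalan_gf m (- x)\<bar> ^ (k - j - l)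
         * (mult_polylog ((l + 2) # replicate j 1) (1 - fuss_catalan_gf m (- x))
            + real m * mult_polylog ((l + 1) # replicate (j + 1) 1) (1 - fuss_catalan_gf m (- x)))))"
proof -
  \<comment> \<open>The exponent p + 1 of the series is \<open>Suc (Suc q)\<close>, so the preceding
    equality applies at level \<open>q\<close>.\<close>
  define q where "q = p - 1"
  have p: "p = Suc q" using assms(2) by (simp add: q_def)
  let ?y = "1 - fuss_catalan_gf m (- x)"
  define t :: "nat \<Rightarrow> nat \<Rightarrow> nat \<Rightarrow> real" where "t = (\<lambda>k j l. (- 1) ^ (l + k) * (real (j + 1) * real m ^ (j + 1) / (fact (q - k) * fact (k - j - l)))
    * ln \<bar>x\<bar> ^ (q - k) * ln \<bar>?y\<bar> ^ (k - j - l)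
    * (mult_polylog ((l + 2) # replicate j 1) ?y + real m * mult_polylog ((l + 1) # replicate (j + 1) 1) ?y))"
  have 1: "(\<Sum>(j, l) \<in> {(j, l). j + l \<le> k}. t k j l) = (\<Sum>j\<le>k. \<Sum>l\<le>k - j. t k j l)" for k
  proof -
    have S: "{(j, l). j + l \<le> k} = Sigma {..k} (\<lambda>j. {..k - j})" by auto
    show ?thesis
      unfolding S by (rule sum.Sigma[symmetric]) auto
  qed
  have 2: "(\<Sum>j\<le>k. \<Sum>l\<le>k - j. t k j l) = (- 1) ^ k / fact (q - k) * ln \<bar>- x\<bar> ^ (q - k) * polylog_sum m k ?y" for k
  proof -
    \<comment> \<open>With a = (-1)^l and b = (-1)^k, this regrouping moves the factors depending
      only on k to the front, which exposes the outer \<open>log_sum\<close>.\<close>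
    have *: "(a * b) * (c / (d * e)) * f * g * h = b / d * f * (c * (a / e * g * h))" for a b c d e f g h :: real
      by simp
    have "t k j l = (- 1) ^ k / fact (q - k) * ln \<bar>- x\<bar> ^ (q - k) * (real (j + 1) * real m ^ (j + 1) *
        ((- 1) ^ l / fact (k - j - l) * ln \<bar>?y\<bar> ^ (k - j - l) * polylog_pair m j l ?y))" for j l
      unfolding t_def power_add[of "- 1" l k] polylog_pair_def abs_minus_cancel by (rule *)
    then show ?thesis
      unfolding polylog_sum_def log_sum_def sum_distrib_left by (intro sum.cong refl)
  qed
  have t: "log_sum (\<lambda>k z. polylog_sum m k (1 - fuss_catalan_gf m z)) q (- x)
    = (\<Sum>k = 0..q. \<Sum>(j, l) \<in> {(j, l). j + l \<le> k}. t k j l)"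
    unfolding log_sum_def atLeast0AtMost 1 2 by (rule refl)
  have x: "\<bar>- x\<bar> \<le> real (m - 1) ^ (m - 1) / real m ^ m"
    using assms(4) by (simp only: abs_minus_cancel)
  have pq: "p + 1 = Suc (Suc q)" "p - 1 = q"
    by (simp_all add: p)
  have "(\<lambda>n. real (m * Suc n choose Suc n) * (- x) ^ Suc n / real (Suc n) ^ Suc (Suc q)) sums
      - (\<Sum>k = 0..q. \<Sum>(j, l) \<in> {(j, l). j + l \<le> k}. t k j l)"
    unfolding t[symmetric] binomial_power_series_eq[OF assms(1) x, symmetric]
    by (rule binomial_power_series_sums[OF assms(1) x])
  then show ?thesis
    unfolding pq t_def .
qed

end
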